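(* Let $\beta$ be hyperbolic and assume that $$\bar X(\beta)\cap \mathrm{cl}(B_\beta(1))=\bar Z\cap\pi_c^{-1}(\mathcal R^{\mathrm o})\cap \mathrm{cl}(B_\beta(1)).$$ Then there exists a finite set $\Delta=\{v_1,\dots,v_k\}$ of translations ($v_j\in\mathbb R$) such that for any $j\in\{1,\dots,k\}$ there is a function $f_j:\mathcal R\to\mathbb R$ such that for any $x\in X(\beta)$ with $x+v_j\in X(\beta)$ we have $$\ln\left(\frac{\mu(x+v_j)}{\mu(x)}\right)=f_j(x_c).$$ Furthermore, any $x\in X(\beta)$ can be reached from $0$ by applying a finite number of translations from $\Delta$. Moreover, there exist a (non-empty, finite) word $w$ over $\{-1,0,1\}$ and constants $C_1>0$, $C_2\in(0,1)$ such that for any word $a_1\cdots a_n\in\{-1,0,1\}^n$ which contains $r\ge 1$ non-overlapping copies of the word $w$, and any $j$, the function $f_j$ varies by at most $C_1C_2^{r-1}$ on $S_{a_1}\circ\cdots\circ S_{a_n}(\mathcal R)$, i.e. $|f_j(y)-f_j(y')|\le C_1C_2^{r-1}$ for all $y,y'\in S_{a_1}\circ\cdots\circ S_{a_n}(\mathcal R)$.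
   Context: A real number $\beta>1$ is called hyperbolic if it is an algebraic integer, is a root of a nonzero polynomial with coefficients in $\{-1,0,1\}$, and has no Galois conjugate of absolute value one (then $\beta\in(1,2)$). $X(\beta):=\left\{\sum_{i=1}^n c_i\beta^{n-i}: n\in\mathbb N,\ c_i\in\{-1,0,1\}\right\}$. For $x\in\mathbb R$, $n\in\mathbb N$, $\mathcal N_n(x)=\#\{(a_1,\dots,a_n,b_1,\dots,b_n)\in\{0,1\}^{2n}: \sum_{i=1}^n (a_i-b_i)\beta^{n-i}=x\}$. $\lambda>1$ denotes the (unique) real number such that for every $x\in X(\beta)$ the limit $\mu(x):=\lim_{n\to\infty}\lambda^{-n}\mathcal N_n(x)$ exists and lies in $(0,\infty)$ (such a $\lambda$ exists). Write the Galois conjugates of $\beta$ (including $\beta$ itself) as $\beta=\beta_1,\beta_2,\dots,\beta_{d+s}$ with $|\beta_1|,\dots,|\beta_d|>1$ and $|\beta_{d+1}|,\dots,|\beta_{d+s}|<1$. Let $\mathbb F_i=\mathbb R$ if $\beta_i\in\mathbb R$ and $\mathbb F_i=\mathbb C$ if $\beta_i\in\mathbb C\setminus\mathbb R$; $\mathbb K=\prod_{i=1}^{d+s}\mathbb F_i$; $\mathbb K_c=\mathbb F_{d+1}\times\cdots\times\mathbb F_{d+s}$; $\pi_c:\mathbb K\to\mathbb K_c$, $\pi_c(x_1,\dots,x_{d+s})=(x_{d+1},\dots,x_{d+s})$. Put $\bar\beta^n=(\beta_1^n,\dots,\beta_{d+s}^n)$, $$\bar Z=\Big\{\sum_{i=0}^{d+s-1}a_i\bar\beta^i: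 a_i\in\mathbb Z\Big\},\qquad \bar X(\beta)=\Big\{\sum_{i=1}^n a_i\bar\beta^{n-i}: n\in\mathbb N,\ a_i\in\{-1,0,1\}\Big\}.$$ $B_\beta(1)=\prod_{i=1}^{d+s}\{z\in\mathbb F_i:|z|<\tfrac{1}{||\beta_i|-1|}\}$ and $\mathrm{cl}$ denotes closure. For $i\in\{-1,0,1\}$, $S_i:\mathbb K_c\to\mathbb K_c$ is the contraction $S_i(x_{d+1},\dots,x_{d+s})=(\beta_{d+1}x_{d+1}+i,\dots,\beta_{d+s}x_{d+s}+i)$. $\mathcal R\subset\mathbb K_c$ is the attractor of the iterated function system $\{S_{-1},S_0,S_1\}$ (the unique non-empty compact set with $\mathcal R=\bigcup_i S_i(\mathcal R)$), and $\mathcal R^{\mathrm o}$ is its interior. For $x=\sum_{i=1}^n c_i\beta^{n-i}\in X(\beta)$ with $c_i\in\{-1,0,1\}$, $x_c:=\sum_{i=1}^n c_i(\beta_{d+1}^{n-i},\dots,\beta_{d+s}^{n-i})\in\mathcal R$; this does not depend on the choice of code $c_1\cdots c_n$ of $x$. *)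

theory Defs
  imports "HOL-Analysis.Analysis" "HOL-Computational_Algebra.Computational_Algebra"
begin

text \<open>The roots of the minimal polynomial of \<open>\<beta>\<close> over the rationals; \<open>\<beta>\<close> itself is included.\<close>

definition galois_conjugates :: "real \<Rightarrow> complex set" where
  "galois_conjugates \<beta> =
     {z. \<exists>p :: rat poly. irreducible p \<and> lead_coeff p = 1 \<and>
           poly (map_poly of_rat p) \<beta> = 0 \<and> poly (map_poly of_rat p) z = 0}"

definition hyperbolic :: "real \<Rightarrow> bool" where
  "hyperbolic \<beta> \<longleftrightarrow>
     \<beta> > 1 \<and> algebraic_int \<beta> \<and>
     (\<exists>p :: int poly. p \<noteq> 0 \<and> (\<forall>i. coeff p i \<in> {-1, 0, 1}) \<and> poly (map_poly of_int p) \<beta> = 0) \<and>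
     (\<forall>z \<in> galois_conjugates \<beta>. cmod z \<noteq> 1)"

definition words :: "int list set" where
  "words = {c. set c \<subseteq> {-1, 0, 1}}"

text \<open>For \<open>c = [c\<^sub>1, \<dots>, c\<^sub>n]\<close> and \<open>z\<close> this is the sum of the \<open>c\<^sub>i z\<^bsup>n-i\<^esup>\<close>; list positions start at \<open>0\<close>.\<close>

definition word_sum :: "int list \<Rightarrow> 'a::field_char_0 \<Rightarrow> 'a" where
  "word_sum c z = (\<Sum>i<length c. of_int (c ! i) * z ^ (length c - Suc i))"

definition spectrum :: "real \<Rightarrow> real set" where
  "spectrum \<beta> = {word_sum c \<beta> | c. c \<in> words}"

definition num_reps :: "real \<Rightarrow> nat \<Rightarrow> real \<Rightarrow> nat" where
  "num_reps \<beta> n x =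
     card {(a, b).
             length a = n \<and> length b = n \<and> set a \<subseteq> {0, 1} \<and> set b \<subseteq> {0, 1} \<and>
             (\<Sum>i<n. of_int (a ! i - b ! i) * \<beta> ^ (n - Suc i)) = x}"

definition mu :: "real \<Rightarrow> real \<Rightarrow> real \<Rightarrow> real" where
  "mu \<beta> l x = lim (\<lambda>n. real (num_reps \<beta> n x) / l ^ n)"

text \<open>The property that singles out the real number written \<open>\<lambda>\<close> in the mathematical text.\<close>

definition is_growth_rate :: "real \<Rightarrow> real \<Rightarrow> bool" where
  "is_growth_rate \<beta> l \<longleftrightarrow>
     l > 1 \<and>
     (\<forall>x \<in> spectrum \<beta>. convergent (\<lambda>n. real (num_reps \<beta> n x) / l ^ n) \<and> mu \<beta> l x > 0)"

text \<open>
  A product of copies of the reals and the complex numbers, one factor per Galois conjugate, is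
  indexed by the conjugates themselves instead of by \<open>1, \<dots>, d + s\<close>. Its points are the functions
  that are \<open>undefined\<close> outside the index set, and a real factor is the real line inside the complex
  plane. The set \<open>contracting \<beta>\<close> is the index range \<open>d + 1, \<dots>, d + s\<close>.
\<close>

definition contracting :: "real \<Rightarrow> complex set" where
  "contracting \<beta> = {b \<in> galois_conjugates \<beta>. cmod b < 1}"

definition factor :: "complex \<Rightarrow> complex set" where
  "factor b = (if b \<in> \<real> then \<real> else UNIV)"

definition conj_space :: "complex set \<Rightarrow> (complex \<Rightarrow> complex) topology" where
  "conj_space A = product_topology (\<lambda>b. top_of_set (factor b)) A"

abbreviation K_space :: "real \<Rightarrow> (complex \<Rightarrow> complex) topology" where
  "K_space \<beta> \<equiv> conj_space (galois_conjugates \<beta>)"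

abbreviation Kc_space :: "real \<Rightarrow> (complex \<Rightarrow> complex) topology" where
  "Kc_space \<beta> \<equiv> conj_space (contracting \<beta>)"

definition proj_c :: "real \<Rightarrow> (complex \<Rightarrow> complex) \<Rightarrow> complex \<Rightarrow> complex" where
  "proj_c \<beta> x = restrict x (contracting \<beta>)"

text \<open>The number of Galois conjugates is \<open>d + s\<close>.\<close>

definition Z_bar :: "real \<Rightarrow> (complex \<Rightarrow> complex) set" where
  "Z_bar \<beta> =
     {(\<lambda>b \<in> galois_conjugates \<beta>. \<Sum>i<card (galois_conjugates \<beta>). of_int (a i) * b ^ i) |
        a :: nat \<Rightarrow> int. True}"

definition X_bar :: "real \<Rightarrow> (complex \<Rightarrow> complex) set" where
  "X_bar \<beta> = {(\<lambda>b \<in> galois_conjugates \<beta>. word_sum c b) | c. c \<in> words}"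

definition B_box :: "real \<Rightarrow> (complex \<Rightarrow> complex) set" where
  "B_box \<beta> = (\<Pi>\<^sub>E b \<in> galois_conjugates \<beta>. {z \<in> factor b. cmod z < 1 / \<bar>cmod b - 1\<bar>})"

definition ifs_map :: "real \<Rightarrow> int \<Rightarrow> (complex \<Rightarrow> complex) \<Rightarrow> complex \<Rightarrow> complex" where
  "ifs_map \<beta> i x = (\<lambda>b \<in> contracting \<beta>. b * x b + of_int i)"

definition attractor :: "real \<Rightarrow> (complex \<Rightarrow> complex) set" where
  "attractor \<beta> =
     (THE R. R \<noteq> {} \<and> compactin (Kc_space \<beta>) R \<and> R = (\<Union>i \<in> {-1, 0, 1}. ifs_map \<beta> i ` R))"

text \<open>For \<open>a = [a\<^sub>1, \<dots>, a\<^sub>n]\<close>, the outermost map is the one of \<open>a\<^sub>1\<close>.\<close>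

definition cylinder :: "real \<Rightarrow> int list \<Rightarrow> (complex \<Rightarrow> complex) set" where
  "cylinder \<beta> a = foldr (ifs_map \<beta>) a ` attractor \<beta>"

definition contracted :: "real \<Rightarrow> real \<Rightarrow> complex \<Rightarrow> complex" where
  "contracted \<beta> x =
     (THE y. \<exists>c \<in> words. x = word_sum c \<beta> \<and> y = (\<lambda>b \<in> contracting \<beta>. word_sum c b))"

text \<open>The set \<open>P\<close> collects the starting positions of the pairwise non-overlapping copies.\<close>

definition contains_copies :: "nat \<Rightarrow> 'a list \<Rightarrow> 'a list \<Rightarrow> bool" where
  "contains_copies r w a \<longleftrightarrow>
     (\<exists>P :: nat set. finite P \<and> card P = r \<and>
        (\<forall>p \<in> P. p + length w \<le> length a \<and> take (length w) (drop p a) = w) \<and>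
        (\<forall>p \<in> P. \<forall>q \<in> P. p < q \<longrightarrow> p + length w \<le> q))"

text \<open>One translation by an element of \<open>\<Delta>\<close>; both endpoints have to lie in the spectrum.\<close>

definition translation_step :: "real \<Rightarrow> real set \<Rightarrow> real \<Rightarrow> real \<Rightarrow> bool" where
  "translation_step \<beta> \<Delta> x y \<longleftrightarrow> x \<in> spectrum \<beta> \<and> y \<in> spectrum \<beta> \<and> (\<exists>v \<in> \<Delta>. y = x + v)"

end

theory Submission
  imports Defs
begin

text \<open>
  Let \<open>\<mu>\<close> be extended by \<open>0\<close> outside the spectrum. Splitting off the last \<open>k\<close> digits of a
  representation gives \<open>l ^ k * \<mu> x = (\<Sum>z\<in>X k. num_reps \<beta> k z * \<mu> ((x - z) / \<beta> ^ k))\<close>, where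
  \<open>X k\<close> is the set of sums of \<open>k\<close> digits (\<open>mu_step\<close>). Fix a word \<open>a\<close> of length \<open>n\<close> with sum \<open>a*\<close>
  and put \<open>x = a* + \<beta> ^ n * u\<close>. The numbers that appear on the right-hand side for \<open>x + t\<close> are
  of the form \<open>u + s\<close>, and their coefficients depend on \<open>a\<close>, \<open>t\<close> and \<open>s\<close> only. If \<open>t\<close> is a
  difference of two sums of \<open>k\<close> digits divided by \<open>\<beta> ^ k\<close>, then \<open>s\<close> is of the same kind with
  \<open>k + n\<close> instead of \<open>k\<close>; its expanding conjugates are bounded, and so are its contracting ones
  as soon as \<open>u + s\<close> lies in the spectrum. Numbers of this kind are called gaps. There are only
  finitely many of them, because \<open>\<int>[\<beta>]\<close> is discrete in the product of its embeddings
  (\<open>finite_bounded_conjugates\<close>). Thus the vector of the values \<open>\<mu> (x + t)\<close>, with \<open>t\<close> ranging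
  over the gaps, is the image of the vector of the values \<open>\<mu> (u + s)\<close> under a nonnegative matrix
  that depends only on \<open>a\<close> (\<open>mu_place\<close>). The set \<open>\<Delta>\<close> consists of the gaps, and the quotient
  \<open>\<mu> (x + t) / \<mu> x\<close> compares two coordinates of the vector.

  A product of positive matrices forgets the vector to which it is applied exponentially fast,
  up to a scalar factor. The matrices at hand are not positive, but there is a word \<open>w = w1 @ v\<close>
  whose matrix is positive on a set of rows times a set of columns and whose other entries do
  not count. The word \<open>v\<close> is such that whatever gap can be reached along \<open>v\<close> can be reached from
  the gap \<open>0\<close> (\<open>column_word\<close>). The word \<open>w1\<close> leads every gap to \<open>0\<close> unless it leads it only to
  gaps that are not mergeable, that is, cannot be brought to \<open>0\<close> at all (\<open>row_word\<close>). The
  interplay of the two excludes the second case for all rows that matter (\<open>alive_row\<close>): by the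
  choice of \<open>v\<close>, the base point in front of \<open>v\<close> lies in the spectrum, so the gaps there are
  differences of two numbers in the spectrum and hence mergeable. Therefore each copy of \<open>w\<close>
  contracts the ratios by a fixed factor (\<open>sandwich_contract\<close>, \<open>sandwich_copies\<close>).

  This bounds the variation of the prescribed values on a cylinder. Since cylinders overlap, the
  values must also be compatible across different cylinders through one point of the attractor
  before they can be extended to the whole attractor. Two addresses of one point are again
  separated by gaps, and inside a copy of \<open>w\<close> one address can be exchanged for the other
  (\<open>linking_point\<close>). For this reason the word of the theorem is \<open>w @ w\<close>. The extension takes the
  supremum of the lower bounds that the prescribed values impose.

  Every number in the spectrum can be reached from \<open>0\<close> because steps by gaps lift along the maps
  \<open>\<lambda>x. \<beta> * x + i\<close> (\<open>linked_lift\<close>).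
\<close>

section \<open>Galois conjugation on the ring generated by \<open>\<beta>\<close>\<close>

abbreviation ipoly :: "int poly \<Rightarrow> 'a::field_char_0 \<Rightarrow> 'a" where
  "ipoly q z \<equiv> poly (map_poly of_int q) z"

abbreviation rpoly :: "rat poly \<Rightarrow> 'a::field_char_0 \<Rightarrow> 'a" where
  "rpoly q z \<equiv> poly (map_poly of_rat q) z"

lemma rpoly_pCons: "rpoly (pCons c p) z = of_rat c + z * rpoly p z"
  by (simp add: map_poly_pCons)

lemma rpoly_add: "rpoly (p + q) z = rpoly p z + rpoly q z"
proof -
  have "map_poly of_rat (p + q) = (map_poly of_rat p + map_poly of_rat q :: 'a poly)"
    by (intro poly_eqI) (simp add: coeff_map_poly of_rat_add)
  then show ?thesis by simp
qed

lemma rpoly_smult: "rpoly (smult c p) z = of_rat c * rpoly p z"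
  by (simp add: map_poly_smult of_rat_mult)

lemma rpoly_mult: "rpoly (p * q) z = rpoly p z * rpoly q z"
proof (induction p)
  case (pCons c p)
  then show ?case
    by (simp add: rpoly_add rpoly_smult rpoly_pCons algebra_simps)
qed simp

lemma rpoly_sum: "finite S \<Longrightarrow> rpoly (sum f S) z = (\<Sum>i\<in>S. rpoly (f i) z)"
  by (induction S rule: finite_induct) (simp_all add: rpoly_add)

lemma rpoly_monom: "rpoly (monom 1 n) z = z ^ n"
  by (simp add: map_poly_monom poly_monom)

lemma ipoly_pCons: "ipoly (pCons c p) z = of_int c + z * ipoly p z"
  by (simp add: map_poly_pCons)

lemma ipoly_add: "ipoly (p + q) z = ipoly p z + ipoly q z"
proof -
  have "map_poly of_int (p + q) = (map_poly of_int p + map_poly of_int q :: 'a poly)"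
    by (intro poly_eqI) (simp add: coeff_map_poly)
  then show ?thesis by simp
qed

lemma ipoly_minus: "ipoly (- p) z = - ipoly p z"
  using ipoly_add[of p "- p" z] by (simp add: eq_neg_iff_add_eq_0 add.commute)

lemma ipoly_diff: "ipoly (p - q) z = ipoly p z - ipoly q z"
  using ipoly_add[of p "- q" z] by (simp add: ipoly_minus)

lemma ipoly_smult: "ipoly (smult c p) z = of_int c * ipoly p z"
  by (simp add: map_poly_smult)

lemma ipoly_mult: "ipoly (p * q) z = ipoly p z * ipoly q z"
proof (induction p)
  case (pCons c p)
  then show ?case
    by (simp add: ipoly_add ipoly_smult ipoly_pCons algebra_simps)
qed simp

lemma ipoly_altdef: "ipoly p z = (\<Sum>i\<le>degree p. of_int (coeff p i) * z ^ i)"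
  by (simp add: poly_altdef degree_map_poly coeff_map_poly)

lemma ipoly_eq_rpoly: "ipoly p z = rpoly (map_poly of_int p) z"
  by (simp add: map_poly_map_poly o_def)

text \<open>
  A polynomial of least degree among the nonzero ones that vanish at \<open>z\<close> divides all of them,
  so the irreducible \<open>p\<close> differs from it only by a unit.
\<close>

lemma dvd_of_common_root:
  fixes p q :: "rat poly" and z :: "'a::field_char_0"
  assumes "irreducible p" "rpoly p z = 0" "rpoly q z = 0"
  shows "p dvd q"
proof -
  define S where "S = {r :: rat poly. r \<noteq> 0 \<and> rpoly r z = 0}"
  have "p \<in> S" using assms by (auto simp: S_def)
  then obtain m where m: "m \<in> S" and min: "\<And>r. r \<in> S \<Longrightarrow> degree m \<le> degree r"
    using ex_has_least_nat[of "\<lambda>r. r \<in> S" p degree] by blast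
  have m0: "m \<noteq> 0" "rpoly m z = 0" using m by (auto simp: S_def)
  have dvd: "m dvd r" if "rpoly r z = 0" for r
  proof (rule ccontr)
    assume "\<not> m dvd r"
    then have nz: "r mod m \<noteq> 0" by (simp add: mod_eq_0_iff_dvd)
    have "rpoly (r div m * m + r mod m) z = 0" using that by simp
    then have "rpoly (r mod m) z = 0" using m0 unfolding rpoly_add rpoly_mult by simp
    then have "degree m \<le> degree (r mod m)" using nz by (intro min) (simp add: S_def)
    then show False using degree_mod_less[OF m0(1), of r] nz by simp
  qed
  obtain k where k: "p = m * k" using dvd[OF assms(2)] by (rule dvdE)
  have "\<not> is_unit m"
  proof
    assume "is_unit m"
    then obtain r where "m * r = 1" by (metis dvdE)
    then have "rpoly (m * r) z = rpoly 1 z" by simp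
    then show False using m0 by (simp add: rpoly_mult)
  qed
  then have "is_unit k" using assms(1) k by (auto dest: irreducibleD)
  then have "p dvd m" using k by (simp add: mult_unit_dvd_iff)
  then show ?thesis using dvd[OF assms(3)] dvd_trans by blast
qed

text \<open>
  There are no double roots: a common root with the derivative would make \<open>p\<close> divide a nonzero
  polynomial of smaller degree.
\<close>

lemma card_roots_irreducible:
  fixes p :: "rat poly"
  assumes "irreducible p"
  shows "card {z::complex. rpoly p z = 0} = degree p"
proof -
  let ?P = "map_poly of_rat p :: complex poly"
  have p0: "p \<noteq> 0" using assms by auto
  have deg: "degree p > 0"
    using assms p0 by (metis irreducible_def is_unit_iff_degree neq0_conv)
  have nz: "?P \<noteq> 0" by (simp add: map_poly_eq_0_iff p0)
  have pd: "pderiv ?P = map_poly of_rat (pderiv p)"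
    by (intro poly_eqI) (simp add: coeff_pderiv coeff_map_poly of_rat_mult of_rat_add)
  have "\<not> (poly ?P z = 0 \<and> poly (pderiv ?P) z = 0)" for z
  proof
    assume *: "poly ?P z = 0 \<and> poly (pderiv ?P) z = 0"
    then have "p dvd pderiv p"
      using dvd_of_common_root[OF assms, of z "pderiv p"] pd by simp
    moreover have "pderiv p \<noteq> 0" using deg by (simp add: pderiv_eq_0_iff)
    ultimately have "degree p \<le> degree (pderiv p)" by (rule dvd_imp_degree_le)
    then show False using deg by (simp add: degree_pderiv)
  qed
  then have "rsquarefree ?P" by (simp add: rsquarefree_roots)
  then have "smult (lead_coeff ?P) (\<Prod>z|poly ?P z = 0. [:-z, 1:]) = ?P"
    by (rule complex_poly_decompose_rsquarefree)
  then have "degree ?P = degree (\<Prod>z|poly ?P z = 0. [:-z, 1:])"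
    using nz by (metis degree_smult_eq leading_coeff_0_iff)
  also have "\<dots> = card {z. poly ?P z = 0}"
    by (subst degree_prod_sum_eq) auto
  finally show ?thesis by (simp add: degree_map_poly)
qed

lemma exists_monic_irreducible:
  fixes z :: "'a::field_char_0"
  assumes "q \<noteq> 0" "rpoly q z = 0"
  obtains p where "irreducible p" "lead_coeff p = 1" "rpoly p z = 0"
proof -
  define S where "S = {q. q \<noteq> 0 \<and> rpoly q z = 0}"
  have "q \<in> S" using assms by (simp add: S_def)
  then obtain p where p: "p \<in> S" and min: "\<And>r. r \<in> S \<Longrightarrow> degree p \<le> degree r"
    using ex_has_least_nat[of "\<lambda>r. r \<in> S" q degree] by blast
  define m where "m = smult (inverse (lead_coeff p)) p"
  have p0: "p \<noteq> 0" "rpoly p z = 0" using p by (auto simp: S_def)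
  have mon: "lead_coeff m = 1" "m \<noteq> 0" "rpoly m z = 0" "degree m = degree p"
    using p0 by (auto simp: m_def rpoly_smult)
  have unit: "is_unit b" if "b \<noteq> 0" "a \<noteq> 0" "m = a * b" "rpoly a z = 0" for a b :: "rat poly"
  proof -
    have "degree p \<le> degree a" using that by (intro min) (auto simp: S_def)
    moreover have "degree p = degree a + degree b"
      using that mon by (metis degree_mult_eq)
    ultimately show ?thesis using \<open>b \<noteq> 0\<close> by (simp add: is_unit_iff_degree)
  qed
  have "irreducible m"
  proof (rule irreducibleI)
    show "m \<noteq> 0" by (fact mon)
    show "\<not> is_unit m"
    proof
      assume "is_unit m"
      then obtain r where "m * r = 1" by (metis dvdE)
      then have "rpoly (m * r) z = rpoly 1 z" by simp
      then show False using mon by (simp add: rpoly_mult)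
    qed
    fix a b assume ab: "m = a * b"
    then have "a \<noteq> 0" "b \<noteq> 0" using mon by auto
    moreover have "rpoly a z = 0 \<or> rpoly b z = 0"
      using mon ab by (simp add: rpoly_mult)
    ultimately show "is_unit a \<or> is_unit b"
      using unit[of b a] unit[of a b] ab by (metis mult.commute)
  qed
  then show ?thesis using that mon by blast
qed

text \<open>
  Lagrange interpolation writes every coefficient as a fixed linear combination of the values at
  the nodes.
\<close>

lemma coeff_bounded_by_values:
  fixes C :: "complex set"
  assumes fin: "finite C"
  obtains K where "\<And>p B j. \<lbrakk>degree p < card C; \<And>b. b \<in> C \<Longrightarrow> cmod (poly p b) \<le> B\<rbrakk>
    \<Longrightarrow> cmod (coeff p j) \<le> K j * B"
proof -
  define L where "L b = smult (inverse (\<Prod>a\<in>C - {b}. b - a)) (\<Prod>a\<in>C - {b}. [:- a, 1:])" for b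
  have L: "poly (L b) a = (if a = b then 1 else 0)" if "a \<in> C" "b \<in> C" for a b
    using that fin by (auto simp: L_def poly_prod prod_zero_iff)
  have degL: "degree (L b) < card C" if "b \<in> C" for b
  proof -
    have "degree (\<Prod>a\<in>C - {b}. [:- a, 1:]) = card (C - {b})"
      by (subst degree_prod_sum_eq) auto
    moreover have "degree (L b) \<le> degree (\<Prod>a\<in>C - {b}. [:- a, 1:])"
      by (simp add: L_def)
    moreover have "card (C - {b}) < card C" using that fin by (rule card_Diff1_less[rotated])
    ultimately show ?thesis by simp
  qed
  have "cmod (coeff p j) \<le> (\<Sum>b\<in>C. cmod (coeff (L b) j)) * B"
    if deg: "degree p < card C" and B: "\<And>b. b \<in> C \<Longrightarrow> cmod (poly p b) \<le> B" for p B j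
  proof -
    define s where "s = (\<Sum>b\<in>C. smult (poly p b) (L b))"
    have c0: "card C > 0" using deg by simp
    have "degree s < card C"
      unfolding s_def
      using degL c0 by (intro degree_sum_less) (auto intro: le_less_trans[OF degree_smult_le])
    have "poly p a = poly s a" if "a \<in> C" for a
    proof -
      have "poly s a = (\<Sum>b\<in>C. if b = a then poly p b else 0)"
        unfolding s_def poly_sum by (intro sum.cong) (auto simp: L that)
      then show ?thesis using that fin by simp
    qed
    then have ss: "C \<subseteq> {x. poly (p - s) x = 0}" by auto
    have "p - s = 0"
    proof (rule ccontr)
      assume nz: "p - s \<noteq> 0"
      then have "card C \<le> card {x. poly (p - s) x = 0}"
        using ss by (intro card_mono poly_roots_finite)
      also have "\<dots> \<le> degree (p - s)" using nz by (rule card_poly_roots_bound)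
      also have "\<dots> < card C" using deg \<open>degree s < card C\<close> by (rule degree_diff_less)
      finally show False by simp
    qed
    then have "p = s" by simp
    then have "coeff p j = coeff s j" by (rule arg_cong)
    then have "coeff p j = (\<Sum>b\<in>C. poly p b * coeff (L b) j)"
      by (simp add: s_def coeff_sum)
    then have "cmod (coeff p j) \<le> (\<Sum>b\<in>C. cmod (poly p b * coeff (L b) j))"
      by (simp add: norm_sum)
    also have "\<dots> \<le> (\<Sum>b\<in>C. B * cmod (coeff (L b) j))"
      by (intro sum_mono) (simp add: norm_mult mult_right_mono B)
    finally show ?thesis by (simp add: sum_distrib_left mult.commute)
  qed
  then show ?thesis by (intro that[of "\<lambda>j. \<Sum>b\<in>C. cmod (coeff (L b) j)"]) blast
qed

lemma rat_common_denominator: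
  fixes S :: "rat set"
  assumes "finite S"
  obtains D :: int where "D > 0" "\<And>x. x \<in> S \<Longrightarrow> of_int D * x \<in> \<int>"
  using assms
proof (induction S arbitrary: thesis rule: finite_induct)
  case empty
  show ?case by (rule empty[of 1]) auto
next
  case (insert y S)
  obtain D where D: "D > 0" "\<And>x. x \<in> S \<Longrightarrow> of_int D * x \<in> \<int>" using insert.IH by blast
  obtain a b where ab: "y = of_int a / of_int b" "b > 0"
    using quotient_of_div quotient_of_denom_pos by (metis prod.exhaust)
  show ?case
  proof (rule insert.prems[of "D * b"])
    show "D * b > 0" using D ab by simp
    fix x assume "x \<in> insert y S"
    moreover have "of_int (D * b) * y = of_int (D * a)" using ab by simp
    moreover have "of_int (D * b) * x = of_int b * (of_int D * x)" by simp
    ultimately show "of_int (D * b) * x \<in> \<int>"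
      using D(2) by (metis Ints_mult Ints_of_int insertE)
  qed
qed

locale hyperbolic_number =
  fixes \<beta> :: real
  assumes hyp: "hyperbolic \<beta>"
begin

abbreviation "conjs \<equiv> galois_conjugates \<beta>"
abbreviation "contr \<equiv> contracting \<beta>"
abbreviation "digits \<equiv> {-1, 0, 1 :: int}"

lemma beta_gt1: "\<beta> > 1" and conj_norm: "b \<in> conjs \<Longrightarrow> cmod b \<noteq> 1"
  using hyp by (auto simp: hyperbolic_def)

lemma beta_ne0[simp]: "\<beta> \<noteq> 0" using beta_gt1 by simp

definition min_poly :: "rat poly" where
  "min_poly = (SOME p. irreducible p \<and> lead_coeff p = 1 \<and> rpoly p \<beta> = 0)"

lemma min_poly: "irreducible min_poly" "lead_coeff min_poly = 1" "rpoly min_poly \<beta> = 0"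
proof -
  obtain q :: "int poly" where q: "q \<noteq> 0" "ipoly q \<beta> = 0"
    using hyp by (auto simp: hyperbolic_def)
  have "map_poly of_int q \<noteq> (0 :: rat poly)" using q by (simp add: map_poly_eq_0_iff)
  moreover have "rpoly (map_poly of_int q) \<beta> = 0" using q by (simp add: ipoly_eq_rpoly)
  ultimately have "\<exists>p. irreducible p \<and> lead_coeff p = 1 \<and> rpoly p \<beta> = 0"
    using exists_monic_irreducible by metis
  then have "irreducible min_poly \<and> lead_coeff min_poly = 1 \<and> rpoly min_poly \<beta> = 0"
    unfolding min_poly_def by (rule someI_ex)
  then show "irreducible min_poly" "lead_coeff min_poly = 1" "rpoly min_poly \<beta> = 0" by auto
qed

lemma conjs_eq: "conjs = {z. rpoly min_poly z = 0}"
proof -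
  have "rpoly min_poly z = 0" if "irreducible p" "rpoly p \<beta> = 0" "rpoly p z = 0" for p :: "rat poly" and z :: complex
    using dvd_of_common_root[OF that(1,2) min_poly(3)] that(3) by (auto simp: rpoly_mult elim!: dvdE)
  then show ?thesis using min_poly by (auto simp: galois_conjugates_def)
qed

text \<open>
  Both sides say that the minimal polynomial divides \<open>q\<close>.
\<close>

lemma rpoly_conj_iff:
  assumes "b \<in> conjs" shows "rpoly q b = 0 \<longleftrightarrow> rpoly q \<beta> = 0"
proof -
  have b: "rpoly min_poly b = 0" using assms by (simp add: conjs_eq)
  have "min_poly dvd q" if "rpoly q b = 0"
    using dvd_of_common_root[OF min_poly(1) b that] .
  moreover have "min_poly dvd q" if "rpoly q \<beta> = 0"
    using dvd_of_common_root[OF min_poly(1,3) that] .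
  ultimately show ?thesis using b min_poly(3) by (auto simp: rpoly_mult elim!: dvdE)
qed

lemma ipoly_conj_iff:
  assumes "b \<in> conjs" shows "ipoly q b = 0 \<longleftrightarrow> ipoly q \<beta> = 0"
  using rpoly_conj_iff[OF assms, of "map_poly of_int q"] by (simp add: ipoly_eq_rpoly)

lemma finite_conjs: "finite conjs" and card_conjs: "card conjs = degree min_poly"
proof -
  show "card conjs = degree min_poly" using card_roots_irreducible[OF min_poly(1)] by (simp add: conjs_eq)
  have "map_poly of_rat min_poly \<noteq> (0::complex poly)"
    using min_poly(1) by (auto simp: map_poly_eq_0_iff)
  then show "finite conjs" unfolding conjs_eq by (rule poly_roots_finite)
qed

text \<open>
  Cancelling powers of the variable makes the constant coefficient \<open>1\<close> or \<open>-1\<close>; this turns \<open>\<beta>\<close> into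
  a unit of \<open>\<int>[\<beta>]\<close>.
\<close>

lemma small_poly:
  obtains p :: "int poly" where "p \<noteq> 0" "\<And>i. coeff p i \<in> {-1, 0, 1}" "ipoly p \<beta> = 0" "coeff p 0 \<noteq> 0"
proof -
  obtain q :: "int poly" where q: "q \<noteq> 0" "\<forall>i. coeff q i \<in> {-1, 0, 1}" "ipoly q \<beta> = 0"
    using hyp by (auto simp: hyperbolic_def)
  have "\<exists>p. p \<noteq> 0 \<and> (\<forall>i. coeff p i \<in> {-1, 0, 1}) \<and> ipoly p \<beta> = 0 \<and> coeff p 0 \<noteq> 0"
    using q
  proof (induction q)
    case (pCons a q)
    show ?case
    proof (cases "a = 0")
      case True
      have "coeff q i \<in> {-1,0,1}" for i
        using pCons.prems(2)[rule_format, of "Suc i"] by simp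
      moreover have "q \<noteq> 0" using pCons.prems(1) True by auto
      moreover have "ipoly q \<beta> = 0" using pCons.prems(3) True by (simp add: ipoly_pCons)
      ultimately show ?thesis using pCons.IH by blast
    next
      case False
      then show ?thesis using pCons.prems by (intro exI[of _ "pCons a q"]) auto
    qed
  qed simp
  then show ?thesis using that by blast
qed

definition Zbeta :: "real set" where "Zbeta = {ipoly q \<beta> | q. True}"

text \<open>
  The embedding of \<open>\<int>[\<beta>]\<close> that sends \<open>\<beta>\<close> to its conjugate \<open>b\<close>. All polynomials that represent the
  same number have the same value at \<open>b\<close>, so the choice is harmless.
\<close>

definition emb :: "complex \<Rightarrow> real \<Rightarrow> complex" where
  "emb b x = ipoly (SOME q. ipoly q \<beta> = x) b"

lemma emb_ipoly: "b \<in> conjs \<Longrightarrow> emb b (ipoly q \<beta>) = ipoly q b"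
proof -
  assume b: "b \<in> conjs"
  define r where "r = (SOME r. ipoly r \<beta> = ipoly q \<beta>)"
  have "ipoly r \<beta> = ipoly q \<beta>" unfolding r_def by (rule someI[of _ q]) simp
  then have "ipoly (r - q) \<beta> = 0" by (simp add: ipoly_diff)
  then have "ipoly (r - q) b = 0" using ipoly_conj_iff[OF b] by simp
  then show ?thesis by (simp add: emb_def r_def ipoly_diff)
qed

lemma Zbeta_add: "x \<in> Zbeta \<Longrightarrow> y \<in> Zbeta \<Longrightarrow> x + y \<in> Zbeta"
  unfolding Zbeta_def using ipoly_add by (smt (verit) mem_Collect_eq)
lemma Zbeta_diff: "x \<in> Zbeta \<Longrightarrow> y \<in> Zbeta \<Longrightarrow> x - y \<in> Zbeta"
  unfolding Zbeta_def using ipoly_diff by (smt (verit) mem_Collect_eq)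
lemma Zbeta_mult: "x \<in> Zbeta \<Longrightarrow> y \<in> Zbeta \<Longrightarrow> x * y \<in> Zbeta"
  unfolding Zbeta_def using ipoly_mult by (smt (verit) mem_Collect_eq)

lemma emb_add: "b \<in> conjs \<Longrightarrow> x \<in> Zbeta \<Longrightarrow> y \<in> Zbeta \<Longrightarrow> emb b (x + y) = emb b x + emb b y"
  unfolding Zbeta_def by (auto simp: emb_ipoly simp flip: ipoly_add)
lemma emb_diff: "b \<in> conjs \<Longrightarrow> x \<in> Zbeta \<Longrightarrow> y \<in> Zbeta \<Longrightarrow> emb b (x - y) = emb b x - emb b y"
  unfolding Zbeta_def by (auto simp: emb_ipoly simp flip: ipoly_diff)
lemma emb_mult: "b \<in> conjs \<Longrightarrow> x \<in> Zbeta \<Longrightarrow> y \<in> Zbeta \<Longrightarrow> emb b (x * y) = emb b x * emb b y"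
  unfolding Zbeta_def by (auto simp: emb_ipoly simp flip: ipoly_mult)

lemma Zbeta_int: "of_int k \<in> Zbeta" and emb_int: "b \<in> conjs \<Longrightarrow> emb b (of_int k) = of_int k"
proof -
  show "of_int k \<in> Zbeta" unfolding Zbeta_def by (auto intro!: exI[of _ "[:k:]"] simp: map_poly_pCons)
  show "b \<in> conjs \<Longrightarrow> emb b (of_int k) = of_int k" using emb_ipoly[of b "[:k:]"] by (simp add: map_poly_pCons)
qed

lemma Zbeta_beta: "\<beta> \<in> Zbeta" and emb_beta: "b \<in> conjs \<Longrightarrow> emb b \<beta> = b"
proof -
  show "\<beta> \<in> Zbeta" unfolding Zbeta_def by (auto intro!: exI[of _ "[:0,1:]"] simp: map_poly_pCons)
  show "b \<in> conjs \<Longrightarrow> emb b \<beta> = b" using emb_ipoly[of b "[:0,1:]"] by (simp add: map_poly_pCons)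
qed

lemma Zbeta_inv: "1 / \<beta> \<in> Zbeta"
proof -
  obtain p :: "int poly" where p: "\<And>i. coeff p i \<in> {-1, 0, 1}" "ipoly p \<beta> = 0" "coeff p 0 \<noteq> 0"
    using small_poly by metis
  obtain a q where pq: "p = pCons a q" by (cases p) auto
  have a: "a = 1 \<or> a = -1" using p(1)[of 0] p(3) pq by auto
  have "of_int a + \<beta> * ipoly q \<beta> = 0" using p(2) pq by (simp add: ipoly_pCons)
  then have "1 / \<beta> = ipoly (smult (- a) q) \<beta>"
    using a unfolding ipoly_smult by (auto simp: field_simps)
  then show ?thesis unfolding Zbeta_def by blast
qed

lemma Zbeta_pow: "x \<in> Zbeta \<Longrightarrow> x ^ n \<in> Zbeta"
  using Zbeta_int[of 1] by (induction n) (auto intro: Zbeta_mult)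

lemma emb_pow: "b \<in> conjs \<Longrightarrow> x \<in> Zbeta \<Longrightarrow> emb b (x ^ n) = emb b x ^ n"
  using emb_int[of b 1] by (induction n) (simp_all add: emb_mult Zbeta_pow)

lemma conj_ne0: "b \<in> conjs \<Longrightarrow> b \<noteq> 0"
  using emb_mult[OF _ Zbeta_beta Zbeta_inv, of b] emb_int[of b 1] by (auto simp: emb_beta)

lemma Zbeta_div: "x \<in> Zbeta \<Longrightarrow> x / \<beta> ^ n \<in> Zbeta"
  using Zbeta_mult[OF _ Zbeta_pow[OF Zbeta_inv], of x n] by (simp add: power_one_over)

lemma emb_div: "b \<in> conjs \<Longrightarrow> x \<in> Zbeta \<Longrightarrow> emb b (x / \<beta> ^ n) = emb b x / b ^ n"
  using emb_mult[OF _ Zbeta_div[of x n] Zbeta_pow[OF Zbeta_beta, of n], of b]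
  by (simp add: emb_pow emb_beta Zbeta_beta conj_ne0 field_simps)

lemma emb_inj: "b \<in> conjs \<Longrightarrow> x \<in> Zbeta \<Longrightarrow> y \<in> Zbeta \<Longrightarrow> emb b x = emb b y \<Longrightarrow> x = y"
proof -
  assume b: "b \<in> conjs" and "x \<in> Zbeta" "y \<in> Zbeta" and eq: "emb b x = emb b y"
  then obtain p q where pq: "x = ipoly p \<beta>" "y = ipoly q \<beta>" by (auto simp: Zbeta_def)
  then have "ipoly (p - q) b = 0" using eq b by (simp add: emb_ipoly ipoly_diff)
  then have "ipoly (p - q) \<beta> = 0" using ipoly_conj_iff[OF b] by blast
  then show ?thesis using pq by (simp add: ipoly_diff)
qed


text \<open>
  A polynomial with coefficients \<open>-1\<close>, \<open>0\<close>, \<open>1\<close> is monic up to sign. So some power \<open>\<beta> ^ N\<close> is itself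
  the sum of a word of length \<open>N\<close>; this gives finitely many generators of the ring, and later it
  makes small integers available as translations.
\<close>

lemma beta_power_digits:
  obtains N e where "N > 0" "\<And>i. e i \<in> digits" "\<beta> ^ N = (\<Sum>i<N. of_int (e i) * \<beta> ^ i)"
proof -
  obtain p :: "int poly" where p: "p \<noteq> 0" "\<And>i. coeff p i \<in> {-1, 0, 1}" "ipoly p \<beta> = 0"
    using small_poly by metis
  define N where "N = degree p"
  define e where "e i = - coeff p N * coeff p i" for i
  have lc: "coeff p N \<in> {-1, 1}" using p(1) p(2)[of N] by (auto simp: N_def)
  have N0: "N > 0"
  proof (rule ccontr)
    assume "\<not> N > 0"
    then have "ipoly p \<beta> = of_int (coeff p N)" by (simp add: ipoly_altdef N_def)
    then show False using p(3) lc by auto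
  qed
  have "0 = (\<Sum>i\<le>N. of_int (coeff p i) * \<beta> ^ i)"
    using p(3) by (simp add: ipoly_altdef N_def)
  also have "\<dots> = (\<Sum>i<N. of_int (coeff p i) * \<beta> ^ i) + of_int (coeff p N) * \<beta> ^ N"
    by (simp add: lessThan_Suc_atMost[symmetric])
  finally have "of_int (coeff p N) * \<beta> ^ N = - (\<Sum>i<N. of_int (coeff p i) * \<beta> ^ i)" by linarith
  then have "of_int (coeff p N) * (of_int (coeff p N) * \<beta> ^ N) = (\<Sum>i<N. of_int (e i) * \<beta> ^ i)"
    by (simp add: sum_negf sum_distrib_left e_def mult.assoc)
  moreover have "of_int (coeff p N) * (of_int (coeff p N) * \<beta> ^ N) = \<beta> ^ N" using lc by auto
  ultimately have "\<beta> ^ N = (\<Sum>i<N. of_int (e i) * \<beta> ^ i)" by simp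
  moreover have "e i \<in> digits" for i using lc p(2)[of i] by (auto simp: e_def)
  ultimately show ?thesis using that[of N e] N0 by blast
qed

lemma Zbeta_finitely_generated:
  obtains N where "\<And>x. x \<in> Zbeta \<Longrightarrow> \<exists>a :: nat \<Rightarrow> int. x = (\<Sum>i<N. of_int (a i) * \<beta> ^ i)"
proof -
  obtain N e where N0: "N > 0" and top: "\<beta> ^ N = (\<Sum>i<N. of_int (e i) * \<beta> ^ i)"
    using beta_power_digits by metis
  have "\<exists>a. ipoly q \<beta> = (\<Sum>i<N. of_int (a i) * \<beta> ^ i)" for q
  proof (induction q)
    case 0
    show ?case by (intro exI[of _ "\<lambda>_. 0"]) simp
  next
    case (pCons c q)
    then obtain a where a: "ipoly q \<beta> = (\<Sum>i<N. of_int (a i) * \<beta> ^ i)" by blast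
    obtain M where M: "N = Suc M" using N0 by (cases N) auto
    define a' where "a' i = (case i of 0 \<Rightarrow> c | Suc j \<Rightarrow> a j) + a M * e i" for i
    have "ipoly (pCons c q) \<beta> = of_int c + \<beta> * (\<Sum>i<N. of_int (a i) * \<beta> ^ i)"
      by (simp add: ipoly_pCons a)
    also have "\<dots> = of_int c + (\<Sum>i<M. of_int (a i) * \<beta> ^ Suc i) + of_int (a M) * \<beta> ^ N"
      by (simp add: M sum_distrib_left algebra_simps)
    also have "of_int c + (\<Sum>i<M. of_int (a i) * \<beta> ^ Suc i)
        = (\<Sum>i<N. of_int (case i of 0 \<Rightarrow> c | Suc j \<Rightarrow> a j) * \<beta> ^ i)"
      unfolding M sum.lessThan_Suc_shift by simp
    also have "of_int (a M) * \<beta> ^ N = (\<Sum>i<N. of_int (a M * e i) * \<beta> ^ i)"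
      by (simp add: top sum_distrib_left mult.assoc)
    finally show ?case
      by (intro exI[of _ a']) (simp add: a'_def sum.distrib[symmetric] distrib_right)
  qed
  then show ?thesis using that[of N] by (auto simp: Zbeta_def)
qed

text \<open>The ring is discrete in the product of all conjugate embeddings.\<close>

text \<open>
  The ring is discrete in the product of its embeddings. Reduced modulo the minimal polynomial, an
  element becomes a rational polynomial whose degree is smaller than the number of conjugates.
  Finite generation gives a common denominator for the coefficients of all these polynomials, and
  interpolation at the conjugates bounds the coefficients, so only finitely many polynomials remain.
\<close>

lemma finite_bounded_conjugates: "finite {x \<in> Zbeta. \<forall>b\<in>conjs. cmod (emb b x) \<le> B}"
proof -
  obtain N where N: "\<And>x. x \<in> Zbeta \<Longrightarrow> \<exists>a :: nat \<Rightarrow> int. x = (\<Sum>i<N. of_int (a i) * \<beta> ^ i)"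
    using Zbeta_finitely_generated by blast
  define n where "n = degree min_poly"
  define R where "R i = monom 1 i mod min_poly" for i
  have m0: "min_poly \<noteq> 0" using min_poly(1) by auto
  have degm: "n > 0" using min_poly(1) m0 unfolding n_def
    by (metis irreducible_def is_unit_iff_degree neq0_conv)
  have R: "rpoly (R i) z = z ^ i" if "rpoly min_poly z = 0" for i and z :: "'a::field_char_0"
  proof -
    have "rpoly (monom 1 i) z = rpoly (monom 1 i div min_poly * min_poly + R i) z"
      by (simp add: R_def)
    then show ?thesis using that by (simp add: rpoly_add rpoly_mult rpoly_monom)
  qed
  have degR: "degree (R i) < n" for i
    using degree_mod_less[OF m0, of "monom 1 i"] degm by (auto simp: R_def n_def)
  obtain D :: int where D: "D > 0" "\<And>x. x \<in> (\<lambda>(i, j). coeff (R i) j) ` ({..<N} \<times> {..<n}) \<Longrightarrow> of_int D * x \<in> \<int>"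
    using rat_common_denominator[of "(\<lambda>(i, j). coeff (R i) j) ` ({..<N} \<times> {..<n})"] by auto
  obtain K where K: "\<And>p B j. \<lbrakk>degree p < card conjs; \<And>b. b \<in> conjs \<Longrightarrow> cmod (poly p b) \<le> B\<rbrakk>
    \<Longrightarrow> cmod (coeff p j) \<le> K j * B"
    using coeff_bounded_by_values[OF finite_conjs] by metis
  define F where "F = (\<Pi>\<^sub>E j\<in>{..<n}. {k :: int. \<bar>real_of_int k\<bar> \<le> of_int D * (K j * B)})"
  have finF: "finite F"
  proof -
    have "finite {k :: int. \<bar>real_of_int k\<bar> \<le> c}" for c
    proof (rule finite_subset)
      show "{k :: int. \<bar>real_of_int k\<bar> \<le> c} \<subseteq> {- \<lfloor>c\<rfloor>..\<lfloor>c\<rfloor>}"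
        by (auto simp: le_floor_iff abs_le_iff) (smt (verit) le_floor_iff of_int_minus)
    qed auto
    then show ?thesis unfolding F_def by (intro finite_PiE) auto
  qed
  have "x \<in> (\<lambda>k. \<Sum>j<n. of_int (k j) / of_int D * \<beta> ^ j) ` F"
    if x: "x \<in> Zbeta" "\<forall>b\<in>conjs. cmod (emb b x) \<le> B" for x
  proof -
    obtain a :: "nat \<Rightarrow> int" where a: "x = (\<Sum>i<N. of_int (a i) * \<beta> ^ i)" using N x by blast
    define r where "r = (\<Sum>i<N. smult (of_int (a i)) (R i))"
    have evr: "rpoly r z = (\<Sum>i<N. of_int (a i) * z ^ i)"
      if "rpoly min_poly z = 0" for z :: "'a::field_char_0"
      using that by (simp add: r_def rpoly_sum rpoly_smult R)
    have xr: "x = rpoly r \<beta>" using evr[OF min_poly(3)] a by simp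
    have degr: "degree r < n" unfolding r_def
      using degR degm by (intro degree_sum_less) (auto intro: le_less_trans[OF degree_smult_le])
    have embx: "emb b x = rpoly r b" if b: "b \<in> conjs" for b
    proof -
      define q where "q = (\<Sum>i<N. monom (a i) i)"
      have q: "ipoly q z = (\<Sum>i<N. of_int (a i) * z ^ i)" for z :: "'b::field_char_0"
        unfolding q_def by (induction N) (simp_all add: ipoly_add map_poly_monom poly_monom)
      show ?thesis using emb_ipoly[OF b, of q] q[of \<beta>] q[of b] a evr[of b] b by (simp add: conjs_eq)
    qed
    have Kr: "\<bar>real_of_rat (coeff r j)\<bar> \<le> K j * B" for j
    proof -
      have "cmod (coeff (map_poly of_rat r) j) \<le> K j * B"
        using degr x(2) embx by (intro K) (auto simp: degree_map_poly card_conjs n_def)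
      moreover have "cmod (of_rat y) = \<bar>real_of_rat y\<bar>" for y
        by (cases y) (simp add: of_rat_rat norm_divide)
      ultimately show ?thesis by (simp add: coeff_map_poly)
    qed
    have "\<exists>k::int. of_int D * coeff r j = of_int k" if "j < n" for j
    proof -
      have "of_int D * coeff r j = (\<Sum>i<N. of_int (a i) * (of_int D * coeff (R i) j))"
        by (simp add: r_def coeff_sum sum_distrib_left algebra_simps)
      also have "\<dots> \<in> \<int>" using that by (intro Ints_sum Ints_mult D(2)) auto
      finally show ?thesis by (auto elim: Ints_cases)
    qed
    then obtain k0 :: "nat \<Rightarrow> int" where k0: "\<And>j. j < n \<Longrightarrow> of_int D * coeff r j = of_int (k0 j)"
      by metis
    have k1: "real_of_int (k0 j) = of_int D * of_rat (coeff r j)" if "j < n" for j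
      using arg_cong[OF k0[OF that], of real_of_rat] by (simp add: of_rat_mult)
    define k where "k = restrict k0 {..<n}"
    have "k \<in> F" unfolding F_def k_def
      using k1 Kr D(1) by (auto simp: abs_mult intro!: mult_left_mono)
    moreover have "x = (\<Sum>j<n. of_int (k j) / of_int D * \<beta> ^ j)"
    proof -
      have "x = (\<Sum>j\<le>degree r. of_rat (coeff r j) * \<beta> ^ j)"
        by (simp add: xr poly_altdef degree_map_poly coeff_map_poly)
      also have "\<dots> = (\<Sum>j<n. of_rat (coeff r j) * \<beta> ^ j)"
        using degr by (intro sum.mono_neutral_left) (auto simp: coeff_eq_0)
      also have "\<dots> = (\<Sum>j<n. of_int (k j) / of_int D * \<beta> ^ j)"
        using D(1) by (intro sum.cong) (auto simp: k_def k1)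
      finally show ?thesis .
    qed
    ultimately show ?thesis by blast
  qed
  then have "{x \<in> Zbeta. \<forall>b\<in>conjs. cmod (emb b x) \<le> B}
      \<subseteq> (\<lambda>k. \<Sum>j<n. of_int (k j) / of_int D * \<beta> ^ j) ` F" by blast
  then show ?thesis using finF finite_surj by blast
qed

text \<open>
  Otherwise the powers of \<open>1 / \<beta>\<close> would be infinitely many ring elements with bounded conjugates.
  The point is that \<open>contracted\<close> is then injective on the spectrum.
\<close>

lemma contr_nonempty: "contr \<noteq> {}"
proof
  assume e: "contr = {}"
  have "cmod b > 1" if "b \<in> conjs" for b
    using that conj_norm[OF that] e by (force simp: contracting_def)
  then have "cmod (emb b (1 / \<beta> ^ n)) \<le> 1" if "b \<in> conjs" for b n
    using that emb_div[OF that Zbeta_int[of 1], of n] emb_int[OF that, of 1] less_imp_le[of 1 "cmod b"]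
      conj_ne0[OF that]
    by (auto simp: norm_divide norm_power divide_le_eq_1 one_le_power)
  moreover have "1 / \<beta> ^ n \<in> Zbeta" for n using Zbeta_div[OF Zbeta_int[of 1], of n] by simp
  ultimately have "range (\<lambda>n. 1 / \<beta> ^ n) \<subseteq> {x \<in> Zbeta. \<forall>b\<in>conjs. cmod (emb b x) \<le> 1}" by auto
  then have "finite (range (\<lambda>n. 1 / \<beta> ^ n))" using finite_bounded_conjugates finite_subset by blast
  moreover have "inj (\<lambda>n. 1 / \<beta> ^ n)"
    using beta_gt1 by (auto simp: inj_def)
  ultimately show False using finite_imageD by fastforce
qed

lemma contr_conj: "b \<in> contr \<Longrightarrow> b \<in> conjs" and contr_lt1: "b \<in> contr \<Longrightarrow> cmod b < 1"
  by (auto simp: contracting_def)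

end

section \<open>The attractor\<close>

context hyperbolic_number begin

text \<open>
  The point whose address is the digit sequence \<open>d\<close>; the digit \<open>d 0\<close> belongs to the outermost map.
\<close>

definition code_point :: "(nat \<Rightarrow> complex) \<Rightarrow> complex \<Rightarrow> complex" where
  "code_point d = (\<lambda>b\<in>contr. \<Sum>k. d k * b ^ k)"

text \<open>
  The digits are complex numbers, so that the topology of the function type makes this set compact
  by Tychonoff's theorem.
\<close>

definition codes :: "(nat \<Rightarrow> complex) set" where
  "codes = UNIV \<rightarrow>\<^sub>E of_int ` digits"

lemma codes_iff: "d \<in> codes \<longleftrightarrow> (\<forall>k. d k \<in> of_int ` digits)"
  by (auto simp: codes_def)

lemma codes_norm: "d \<in> codes \<Longrightarrow> cmod (d k) \<le> 1"
  by (auto simp: codes_iff dest!: spec[of _ k])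

lemma code_term_bound: "d \<in> codes \<Longrightarrow> cmod (d k * b ^ k) \<le> cmod b ^ k"
  using codes_norm[of d k] by (simp add: norm_mult norm_power mult_left_le_one_le)

lemma code_summable:
  assumes "d \<in> codes" "b \<in> contr" shows "summable (\<lambda>k. d k * b ^ k)"
proof (rule summable_comparison_test')
  show "summable (\<lambda>k. cmod b ^ k)" using contr_lt1[OF assms(2)] by (simp add: summable_geometric)
  show "norm (d k * b ^ k) \<le> cmod b ^ k" for k using code_term_bound[OF assms(1)] .
qed

lemma code_point_bound:
  assumes "d \<in> codes" "b \<in> contr" shows "cmod (code_point d b) \<le> 1 / (1 - cmod b)"
proof -
  have g: "summable (\<lambda>k. cmod b ^ k)" using contr_lt1[OF assms(2)] by (simp add: summable_geometric)
  have "cmod (\<Sum>k. d k * b ^ k) \<le> (\<Sum>k. cmod b ^ k)"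
    using norm_suminf_le[OF code_term_bound[OF assms(1)] g] .
  also have "\<dots> = 1 / (1 - cmod b)" using contr_lt1[OF assms(2)] by (simp add: suminf_geometric)
  finally show ?thesis using assms(2) by (simp add: code_point_def)
qed

lemma code_point_factor:
  assumes "d \<in> codes" "b \<in> contr" shows "code_point d b \<in> factor b"
proof (cases "b \<in> \<real>")
  case True
  have "(\<lambda>n. \<Sum>k<n. d k * b ^ k) \<longlonglongrightarrow> (\<Sum>k. d k * b ^ k)"
    using code_summable[OF assms] by (rule summable_LIMSEQ)
  moreover have "(\<Sum>k<n. d k * b ^ k) \<in> \<real>" for n
  proof -
    have "d k \<in> \<real>" for k using assms(1) by (auto simp: codes_iff dest!: spec[of _ k])
    then show ?thesis using True by (intro sum_in_Reals Reals_mult Reals_power) auto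
  qed
  ultimately have "(\<Sum>k. d k * b ^ k) \<in> \<real>"
    by (intro Lim_in_closed_set[OF closed_complex_Reals always_eventually]) auto
  then show ?thesis using True assms(2) by (simp add: factor_def code_point_def)
qed (simp add: factor_def)

lemma topspace_Kc: "topspace (Kc_space \<beta>) = (\<Pi>\<^sub>E b\<in>contr. factor b)"
  by (simp add: conj_space_def)

lemma code_point_topspace: "d \<in> codes \<Longrightarrow> code_point d \<in> topspace (Kc_space \<beta>)"
  unfolding topspace_Kc using code_point_factor by (auto simp: code_point_def)

lemma compactin_code_points: "compactin (Kc_space \<beta>) (code_point ` codes)"
proof -
  have "compactin (product_topology (\<lambda>_. euclidean) UNIV) codes"
    unfolding codes_def compactin_PiE by (auto simp: finite_imp_compact)
  then have "compact codes" by (simp add: euclidean_product_topology)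
  then have c: "compactin (top_of_set codes) codes" by (simp add: compactin_subtopology)
  have "continuous_map (top_of_set codes) (top_of_set (factor b)) (\<lambda>d. code_point d b)"
    if b: "b \<in> contr" for b
  proof -
    have u: "uniform_limit codes (\<lambda>n d. \<Sum>k<n. d k * b ^ k) (\<lambda>d. \<Sum>k. d k * b ^ k) sequentially"
      using contr_lt1[OF b] code_term_bound
      by (intro Weierstrass_m_test[where M = "\<lambda>k. cmod b ^ k"]) (auto simp: summable_geometric)
    have c: "continuous_on codes (\<lambda>d. \<Sum>k<n. d k * b ^ k)" for n
      by (intro continuous_intros continuous_on_subset[OF continuous_on_product_coordinates]) auto
    have "continuous_on codes (\<lambda>d. \<Sum>k. d k * b ^ k)"
      by (rule uniform_limit_theorem[OF always_eventually[OF allI, OF c] u]) simp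
    then have "continuous_on codes (\<lambda>d. code_point d b)" using b by (simp add: code_point_def)
    then show ?thesis using code_point_factor b by auto
  qed
  then have "continuous_map (top_of_set codes) (Kc_space \<beta>) code_point"
    unfolding conj_space_def continuous_map_componentwise by (auto simp: code_point_def)
  then show ?thesis using image_compactin[OF c] by blast
qed

lemma ifs_map_code_point:
  assumes "d \<in> codes"
  shows "ifs_map \<beta> i (code_point d) = code_point (case_nat (of_int i) d)"
proof
  fix b
  show "ifs_map \<beta> i (code_point d) b = code_point (case_nat (of_int i) d) b"
  proof (cases "b \<in> contr")
    case True
    let ?f = "\<lambda>k. case_nat (of_int i) d k * b ^ k"
    have s: "summable (\<lambda>k. d k * b ^ k)" using code_summable[OF assms True] .
    have "(\<lambda>k. ?f (Suc k)) = (\<lambda>k. b * (d k * b ^ k))" by (simp add: algebra_simps)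
    moreover from this have "summable ?f" using summable_mult[OF s, of b] by (subst summable_Suc_iff[symmetric]) simp
    ultimately have "(\<Sum>k. ?f k) = b * (\<Sum>k. d k * b ^ k) + of_int i"
      using suminf_split_head[of ?f] suminf_mult[OF s, of b] by simp
    then show ?thesis using True by (simp add: ifs_map_def code_point_def)
  qed (simp add: ifs_map_def code_point_def)
qed

lemma code_points_invariant:
  "code_point ` codes = (\<Union>i\<in>digits. ifs_map \<beta> i ` code_point ` codes)"
proof (intro subset_antisym subsetI)
  fix y assume "y \<in> code_point ` codes"
  then obtain d where d: "d \<in> codes" "y = code_point d" by blast
  obtain i where i: "i \<in> digits" "d 0 = of_int i" using d(1) unfolding codes_iff by blast
  have tl: "(\<lambda>k. d (Suc k)) \<in> codes" using d(1) by (simp add: codes_iff)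
  have "d = case_nat (of_int i) (\<lambda>k. d (Suc k))" by (auto simp: fun_eq_iff i(2) split: nat.splits)
  then have "y = ifs_map \<beta> i (code_point (\<lambda>k. d (Suc k)))"
    using ifs_map_code_point[OF tl] d(2) by simp
  then show "y \<in> (\<Union>i\<in>digits. ifs_map \<beta> i ` code_point ` codes)" using i(1) tl by blast
next
  fix y assume "y \<in> (\<Union>i\<in>digits. ifs_map \<beta> i ` code_point ` codes)"
  then obtain i d where i: "i \<in> digits" and d: "d \<in> codes" "y = ifs_map \<beta> i (code_point d)" by blast
  have "case_nat (of_int i) d \<in> codes" using i d(1) by (auto simp: codes_iff split: nat.splits)
  then show "y \<in> code_point ` codes" using d ifs_map_code_point by blast
qed

text \<open>
  The composition of the maps with digits \<open>c 0, \<dots>, c (n - 1)\<close>, where \<open>c 0\<close> is outermost.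
\<close>

fun branch :: "(nat \<Rightarrow> int) \<Rightarrow> nat \<Rightarrow> (complex \<Rightarrow> complex) \<Rightarrow> complex \<Rightarrow> complex" where
  "branch c 0 p = p"
| "branch c (Suc n) p = branch c n (ifs_map \<beta> (c n) p)"

lemma branch_apply:
  assumes "b \<in> contr"
  shows "branch c n p b = (\<Sum>k<n. of_int (c k) * b ^ k) + b ^ n * p b"
  using assms by (induction n arbitrary: p) (simp_all add: ifs_map_def algebra_simps)

text \<open>
  The points of an invariant set can be pulled back for ever, and boundedness makes the remainders
  disappear in the limit, so they have an address. Conversely, the images of any point of the set
  along an address stay in the set and converge to the point with that address, and a compact
  set is closed.
\<close>

lemma code_points_unique:
  assumes ne: "R \<noteq> {}" and comp: "compactin (Kc_space \<beta>) R"
    and inv: "R = (\<Union>i\<in>digits. ifs_map \<beta> i ` R)"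
  shows "R = code_point ` codes"
proof -
  have top: "R \<subseteq> (\<Pi>\<^sub>E b\<in>contr. factor b)"
    using compactin_subset_topspace[OF comp] topspace_Kc by blast
  have ext: "p \<in> extensional contr" if "p \<in> R" for p using top that by (auto simp: PiE_def)
  have bdd: "\<exists>B. \<forall>p\<in>R. cmod (p b) \<le> B" if "b \<in> contr" for b
  proof -
    have "continuous_map (Kc_space \<beta>) (top_of_set (factor b)) (\<lambda>x. x b)"
      unfolding conj_space_def using that by (rule continuous_map_product_projection)
    then have "compactin (top_of_set (factor b)) ((\<lambda>x. x b) ` R)" using comp image_compactin by blast
    then have "compact ((\<lambda>x. x b) ` R)" by (simp add: compactin_subtopology)
    then show ?thesis using compact_imp_bounded bounded_iff by (metis imageI)
  qed
  have tail: "(\<lambda>n. b ^ n * p n b) \<longlonglongrightarrow> 0" if "b \<in> contr" "\<And>n. p n \<in> R" for b p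
  proof -
    obtain B where B: "\<forall>p\<in>R. cmod (p b) \<le> B" using bdd[OF \<open>b \<in> contr\<close>] by blast
    have "(\<lambda>n. cmod b ^ n * B) \<longlonglongrightarrow> 0 * B"
      using contr_lt1[OF that(1)] by (intro tendsto_intros LIMSEQ_power_zero) auto
    then have z: "(\<lambda>n. cmod b ^ n * B) \<longlonglongrightarrow> 0" by simp
    show ?thesis
      using that(2) B by (intro Lim_null_comparison[OF _ z]) (auto simp: norm_mult norm_power intro!: always_eventually mult_left_mono)
  qed
  have code_of: "code_point (\<lambda>k. of_int (c k)) b = p' b"
    if "b \<in> contr" "\<And>n. p n \<in> R" "\<And>k. c k \<in> digits" "\<And>n. p' b = branch c n (p n) b" for b p p' c
  proof -
    have "(\<lambda>k. of_int (c k)) \<in> codes" using that(3) unfolding codes_iff by blast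
    then have "(\<lambda>n. \<Sum>k<n. of_int (c k) * b ^ k) \<longlonglongrightarrow> code_point (\<lambda>k. of_int (c k)) b"
      using code_summable that(1) by (simp add: code_point_def summable_LIMSEQ)
    then have "(\<lambda>n. branch c n (p n) b) \<longlonglongrightarrow> code_point (\<lambda>k. of_int (c k)) b + 0"
      unfolding branch_apply[OF that(1)] using tail[OF that(1,2)] by (intro tendsto_add) auto
    then show ?thesis using that(4) LIMSEQ_unique[OF _ tendsto_const] by simp
  qed
  show ?thesis
  proof (intro subset_antisym subsetI)
    fix p assume p: "p \<in> R"
    have "\<exists>q. \<forall>n. (q n \<in> R) \<and> (\<exists>i\<in>digits. q n = ifs_map \<beta> i (q (Suc n)))
        \<and> (n = 0 \<longrightarrow> q n = p)"
    proof -
      have "\<exists>q. \<forall>n. (q n \<in> R \<and> (n = 0 \<longrightarrow> q n = p)) \<and> (\<exists>i\<in>digits. q n = ifs_map \<beta> i (q (Suc n)))"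
      proof (rule dependent_nat_choice)
        show "\<exists>x. x \<in> R \<and> (0 = (0::nat) \<longrightarrow> x = p)" using p by blast
        fix x and n :: nat assume "x \<in> R \<and> (n = 0 \<longrightarrow> x = p)"
        then have "x \<in> (\<Union>i\<in>digits. ifs_map \<beta> i ` R)" using equalityD1[OF inv] by (meson subsetD)
        then show "\<exists>y. (y \<in> R \<and> (Suc n = 0 \<longrightarrow> y = p)) \<and> (\<exists>i\<in>digits. x = ifs_map \<beta> i y)" by blast
      qed
      then show ?thesis by blast
    qed
    then obtain q where q: "\<And>n. q n \<in> R" "\<And>n. \<exists>i\<in>digits. q n = ifs_map \<beta> i (q (Suc n))" "q 0 = p"
      by blast
    then obtain c where c: "\<And>n. c n \<in> digits" "\<And>n. q n = ifs_map \<beta> (c n) (q (Suc n))" by metis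
    have "branch c n (q n) = p" for n
      by (induction n) (simp_all add: q(3) c(2)[symmetric])
    then have "code_point (\<lambda>k. of_int (c k)) b = p b" if "b \<in> contr" for b
      using code_of[OF that, of q c p] q(1) c(1) by simp
    then have "code_point (\<lambda>k. of_int (c k)) = p"
      using ext[OF p] by (intro extensionalityI[of _ contr]) (auto simp: code_point_def)
    moreover have "(\<lambda>k. of_int (c k)) \<in> codes" using c(1) unfolding codes_iff by blast
    ultimately show "p \<in> code_point ` codes" by blast
  next
    fix y assume "y \<in> code_point ` codes"
    then obtain d where d: "d \<in> codes" "y = code_point d" by blast
    then obtain c where c: "\<And>k. c k \<in> digits" "d = (\<lambda>k. of_int (c k))"
      unfolding codes_iff image_iff by metis
    obtain p0 where p0: "p0 \<in> R" using ne by blast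
    have R: "branch c n p \<in> R" if "p \<in> R" for n p
      using that
    proof (induction n arbitrary: p)
      case (Suc n)
      have "ifs_map \<beta> (c n) p \<in> (\<Union>i\<in>digits. ifs_map \<beta> i ` R)" using Suc.prems c(1) by blast
      then have "ifs_map \<beta> (c n) p \<in> R" by (rule subsetD[OF equalityD2[OF inv]])
      then show ?case using Suc.IH by simp
    qed simp
    have "limitin (Kc_space \<beta>) (\<lambda>n. branch c n p0) y sequentially"
    proof -
      have "limitin (top_of_set (factor b)) (\<lambda>n. branch c n p0 b) (y b) sequentially"
        if b: "b \<in> contr" for b
      proof -
        have "(\<lambda>n. \<Sum>k<n. of_int (c k) * b ^ k) \<longlonglongrightarrow> y b"
          using code_summable[OF d(1) b] b d(2) c(2) by (simp add: code_point_def summable_LIMSEQ)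
        then have "(\<lambda>n. branch c n p0 b) \<longlonglongrightarrow> y b + 0"
          unfolding branch_apply[OF b] using tail[OF b, of "\<lambda>_. p0"] p0 by (intro tendsto_add) auto
        moreover have "branch c n p0 b \<in> factor b" for n using R[OF p0] top b by (auto simp: PiE_iff)
        moreover have "y b \<in> factor b" using code_point_factor[OF d(1) b] d(2) by simp
        ultimately show ?thesis by (simp add: limitin_subtopology)
      qed
      then show ?thesis
        unfolding conj_space_def limitin_componentwise
        using code_point_topspace[OF d(1)] d(2) ext R[OF p0] subsetD[OF top R[OF p0]]
        by (auto simp: code_point_def intro!: always_eventually)
    qed
    moreover have "closedin (Kc_space \<beta>) R"
    proof (rule compactin_imp_closedin[OF _ comp])
      show "Hausdorff_space (Kc_space \<beta>)"
        unfolding conj_space_def Hausdorff_space_product_topology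
        by (simp add: Hausdorff_space_subtopology)
    qed
    ultimately show "y \<in> R"
      using R[OF p0] by (intro limitin_closedin[of "Kc_space \<beta>" _ _ sequentially]) auto
  qed
qed

lemma attractor_eq: "attractor \<beta> = code_point ` codes"
  unfolding attractor_def
proof (rule the_equality)
  have "(\<lambda>_. 0) \<in> codes" by (auto simp: codes_iff)
  then show "code_point ` codes \<noteq> {} \<and> compactin (Kc_space \<beta>) (code_point ` codes) \<and>
      code_point ` codes = (\<Union>i\<in>digits. ifs_map \<beta> i ` code_point ` codes)"
    by (intro conjI compactin_code_points code_points_invariant) blast
qed (metis code_points_unique)

lemma attractor_bound: "p \<in> attractor \<beta> \<Longrightarrow> b \<in> contr \<Longrightarrow> cmod (p b) \<le> 1 / (1 - cmod b)"
  using code_point_bound by (auto simp: attractor_eq)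

lemma attractor_step: "p \<in> attractor \<beta> \<Longrightarrow> i \<in> digits \<Longrightarrow> ifs_map \<beta> i p \<in> attractor \<beta>"
  unfolding attractor_eq by (rule subsetD[OF equalityD2[OF code_points_invariant]]) blast

lemma attractor_unstep: "p \<in> attractor \<beta> \<Longrightarrow> \<exists>i\<in>digits. \<exists>q\<in>attractor \<beta>. p = ifs_map \<beta> i q"
  unfolding attractor_eq using subsetD[OF equalityD1[OF code_points_invariant]] by blast

lemma attractor_zero: "(\<lambda>b\<in>contr. 0) \<in> attractor \<beta>"
proof -
  have "(\<lambda>_. 0) \<in> codes" by (auto simp: codes_iff)
  moreover have "code_point (\<lambda>_. 0) = (\<lambda>b\<in>contr. 0)" by (simp add: code_point_def)
  ultimately show ?thesis unfolding attractor_eq by (metis imageI)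
qed

end

section \<open>Sums of words and their representation numbers\<close>

lemma words_append: "c @ d \<in> words \<longleftrightarrow> c \<in> words \<and> d \<in> words"
  by (auto simp: words_def)

lemma words_Cons: "x # c \<in> words \<longleftrightarrow> x \<in> {-1, 0, 1} \<and> c \<in> words"
  by (auto simp: words_def)

lemma words_Nil: "[] \<in> words" by (simp add: words_def)

lemma words_rev: "rev c \<in> words \<longleftrightarrow> c \<in> words" by (simp add: words_def)

lemma word_sum_Nil [simp]: "word_sum [] z = 0" by (simp add: word_sum_def)

lemma word_sum_Cons: "word_sum (x # c) z = of_int x * z ^ length c + word_sum c z"
  unfolding word_sum_def by (simp add: sum.lessThan_Suc_shift del: sum.lessThan_Suc)

lemma word_sum_append: "word_sum (c @ d) z = z ^ length d * word_sum c z + word_sum d z"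
  by (induction c) (simp_all add: word_sum_Cons power_add algebra_simps)

lemma word_sum_minus: "word_sum (map uminus c) z = - word_sum c z"
  by (induction c) (simp_all add: word_sum_Cons)

lemma norm_word_sum_contracting:
  assumes "c \<in> words" "cmod b < 1" shows "cmod (word_sum c b) \<le> 1 / (1 - cmod b)"
  using assms(1)
proof (induction c rule: rev_induct)
  case (snoc i c)
  have "cmod (word_sum (c @ [i]) b) \<le> cmod b * cmod (word_sum c b) + cmod (of_int i)"
    using norm_triangle_ineq[of "b * word_sum c b" "of_int i"]
    by (simp add: word_sum_append word_sum_Cons norm_mult)
  also have "\<dots> \<le> cmod b * (1 / (1 - cmod b)) + 1"
    using snoc by (intro add_mono mult_left_mono) (auto simp: words_append words_Cons)
  also have "\<dots> = 1 / (1 - cmod b)" using assms(2) by (simp add: field_simps)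
  finally show ?case .
qed (use assms in simp)

lemma norm_word_sum_expanding:
  assumes "c \<in> words" "cmod b > 1" shows "cmod (word_sum c b) \<le> cmod b ^ length c / (cmod b - 1)"
proof -
  have "cmod (word_sum c b) \<le> (cmod b ^ length c - 1) / (cmod b - 1)"
    using assms(1)
  proof (induction c rule: rev_induct)
    case (snoc i c)
    have "cmod (word_sum (c @ [i]) b) \<le> cmod b * cmod (word_sum c b) + cmod (of_int i)"
      using norm_triangle_ineq[of "b * word_sum c b" "of_int i"]
      by (simp add: word_sum_append word_sum_Cons norm_mult)
    also have "\<dots> \<le> cmod b * ((cmod b ^ length c - 1) / (cmod b - 1)) + 1"
      using snoc by (intro add_mono mult_left_mono) (auto simp: words_append words_Cons)
    also have "\<dots> = (cmod b ^ length (c @ [i]) - 1) / (cmod b - 1)"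
      using assms(2) by (simp add: field_simps)
    finally show ?case .
  qed simp
  also have "\<dots> \<le> cmod b ^ length c / (cmod b - 1)" using assms(2) by (simp add: divide_right_mono)
  finally show ?thesis .
qed

definition digit_pairs :: "nat \<Rightarrow> (int list \<times> int list) set" where
  "digit_pairs n = {a. length a = n \<and> set a \<subseteq> {0, 1}} \<times> {b. length b = n \<and> set b \<subseteq> {0, 1}}"

definition pair_sum :: "int list \<times> int list \<Rightarrow> real \<Rightarrow> real" where
  "pair_sum p z = word_sum (map2 (-) (fst p) (snd p)) z"

lemma finite_binary_lists: "finite {a :: int list. length a = n \<and> set a \<subseteq> {0, 1}}"
  and card_binary_lists: "card {a :: int list. length a = n \<and> set a \<subseteq> {0, 1}} = 2 ^ n"
  using finite_lists_length_eq[of "{0,1::int}" n] card_lists_length_eq[of "{0,1::int}" n]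
  by (simp_all add: conj_commute eval_nat_numeral)

lemma finite_digit_pairs: "finite (digit_pairs n)" and card_digit_pairs: "card (digit_pairs n) = 4 ^ n"
  by (simp_all add: digit_pairs_def finite_binary_lists card_binary_lists card_cartesian_product
      power_mult_distrib[symmetric])

lemma num_reps_eq: "num_reps \<beta> n x = card {p \<in> digit_pairs n. pair_sum p \<beta> = x}"
proof -
  have "pair_sum (a, b) \<beta> = (\<Sum>i<n. of_int (a ! i - b ! i) * \<beta> ^ (n - Suc i))"
    if "length a = n" "length b = n" for a b
    using that by (auto simp: pair_sum_def word_sum_def intro!: sum.cong)
  then have "{p \<in> digit_pairs n. pair_sum p \<beta> = x} = {(a, b). length a = n \<and> length b = n \<and>
      set a \<subseteq> {0, 1} \<and> set b \<subseteq> {0, 1} \<and> (\<Sum>i<n. of_int (a ! i - b ! i) * \<beta> ^ (n - Suc i)) = x}"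
    by (auto simp: digit_pairs_def)
  then show ?thesis by (simp add: num_reps_def)
qed

lemma num_reps_le: "num_reps \<beta> n x \<le> 4 ^ n"
  unfolding num_reps_eq card_digit_pairs[symmetric]
  by (intro card_mono finite_digit_pairs) auto

context hyperbolic_number begin

text \<open>
  The sums of words of one fixed length. These sets increase with the length, because leading zeros
  may be added, and their union is the spectrum.
\<close>

definition X :: "nat \<Rightarrow> real set" where
  "X n = {word_sum c \<beta> | c. c \<in> words \<and> length c = n}"

lemma XI: "c \<in> words \<Longrightarrow> length c = n \<Longrightarrow> word_sum c \<beta> \<in> X n"
  by (auto simp: X_def)

lemma X_0: "X 0 = {0}" by (auto simp: X_def words_Nil)

lemma X_concat:
  assumes "x \<in> X m" "y \<in> X n" shows "\<beta> ^ n * x + y \<in> X (m + n)"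
proof -
  obtain c d where "c \<in> words" "d \<in> words" "length c = m" "length d = n"
    "x = word_sum c \<beta>" "y = word_sum d \<beta>" using assms by (auto simp: X_def)
  then show ?thesis using XI[of "c @ d" "m + n"] by (simp add: words_append word_sum_append)
qed

lemma X_split:
  assumes "z \<in> X (m + n)" obtains x y where "x \<in> X m" "y \<in> X n" "z = \<beta> ^ n * x + y"
proof -
  obtain c where c: "c \<in> words" "length c = m + n" "z = word_sum c \<beta>" using assms by (auto simp: X_def)
  have "c = take m c @ drop m c" by simp
  then have "take m c \<in> words \<and> drop m c \<in> words" "z = \<beta> ^ n * word_sum (take m c) \<beta> + word_sum (drop m c) \<beta>"
    using c words_append[of "take m c" "drop m c"] word_sum_append[of "take m c" "drop m c" \<beta>] by auto
  then show ?thesis using that XI[of "take m c" m] XI[of "drop m c" n] c by auto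
qed

lemma X_zero: "0 \<in> X n"
proof -
  have "word_sum (replicate n 0) \<beta> = 0" by (induction n) (simp_all add: word_sum_Cons)
  moreover have "replicate n 0 \<in> words" by (auto simp: words_def)
  ultimately show ?thesis using XI[of "replicate n 0" n] by simp
qed

lemma X_mono: "m \<le> n \<Longrightarrow> x \<in> X m \<Longrightarrow> x \<in> X n"
  using X_concat[OF X_zero[of "n - m"], of x m] by simp

lemma X_uminus: "x \<in> X n \<Longrightarrow> - x \<in> X n"
proof -
  assume "x \<in> X n"
  then obtain c where c: "c \<in> words" "length c = n" "x = word_sum c \<beta>" by (auto simp: X_def)
  then have "map uminus c \<in> words" by (auto simp: words_def)
  then show ?thesis using XI[of "map uminus c" n] c by (simp add: word_sum_minus)
qed

lemma finite_X: "finite (X n)"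
proof -
  have "X n = (\<lambda>c. word_sum c \<beta>) ` {c. set c \<subseteq> {-1, 0, 1} \<and> length c = n}"
    by (auto simp: X_def words_def)
  then show ?thesis by (simp add: finite_lists_length_eq)
qed

lemma spectrum_eq: "spectrum \<beta> = (\<Union>n. X n)"
  by (auto simp: spectrum_def X_def)

lemma spectrumI: "x \<in> X n \<Longrightarrow> x \<in> spectrum \<beta>" by (auto simp: spectrum_eq)

lemma spectrum_zero: "0 \<in> spectrum \<beta>" using X_zero by (rule spectrumI)

lemma spectrum_concat: "x \<in> spectrum \<beta> \<Longrightarrow> z \<in> X n \<Longrightarrow> \<beta> ^ n * x + z \<in> spectrum \<beta>"
  unfolding spectrum_eq using X_concat by blast

lemma spectrum_split:
  assumes "x \<in> spectrum \<beta>" obtains y z where "y \<in> spectrum \<beta>" "z \<in> X n" "x = \<beta> ^ n * y + z"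
proof -
  obtain m where "x \<in> X m" using assms by (auto simp: spectrum_eq)
  then have "x \<in> X (m + n)" by (rule X_mono[rotated]) simp
  then show ?thesis using X_split that spectrumI by metis
qed

text \<open>
  Each of the digits \<open>-1\<close>, \<open>0\<close>, \<open>1\<close> is a difference of two binary digits.
\<close>

lemma num_reps_pos_iff: "num_reps \<beta> n x > 0 \<longleftrightarrow> x \<in> X n"
proof
  assume "num_reps \<beta> n x > 0"
  then obtain p where p: "p \<in> digit_pairs n" "pair_sum p \<beta> = x"
    unfolding num_reps_eq card_gt_0_iff by blast
  have "map2 (-) (fst p) (snd p) \<in> words"
  proof -
    have "a - b \<in> {-1,0,1}" if "(a, b) \<in> set (zip (fst p) (snd p))" for a b
    proof -
      have "a \<in> {0, 1}" "b \<in> {0, 1}"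
        using p(1) set_zip_leftD[OF that] set_zip_rightD[OF that] by (auto simp: digit_pairs_def)
      then show ?thesis by auto
    qed
    then show ?thesis by (force simp: words_def)
  qed
  then show "x \<in> X n" using p XI[of "map2 (-) (fst p) (snd p)" n]
    by (auto simp: pair_sum_def digit_pairs_def)
next
  assume "x \<in> X n"
  then obtain c where c: "c \<in> words" "length c = n" "x = word_sum c \<beta>" by (auto simp: X_def)
  define p where "p = (map (\<lambda>i. if i = 1 then 1 else 0 :: int) c, map (\<lambda>i. if i = -1 then 1 else 0 :: int) c)"
  have "map2 (-) (fst p) (snd p) = c"
    using c(1) unfolding p_def by (induction c) (auto simp: words_Cons)
  moreover have "p \<in> digit_pairs n" using c(2) by (auto simp: p_def digit_pairs_def)
  ultimately have "p \<in> {p \<in> digit_pairs n. pair_sum p \<beta> = x}" using c by (simp add: pair_sum_def)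
  moreover have "finite {p \<in> digit_pairs n. pair_sum p \<beta> = x}" using finite_digit_pairs by simp
  ultimately show "num_reps \<beta> n x > 0" unfolding num_reps_eq card_gt_0_iff by blast
qed

text \<open>
  A pair of strings of length \<open>n + k\<close> splits into its \<open>n\<close> leading and its \<open>k\<close> final positions; \<open>z\<close> is
  the sum of the final ones.
\<close>

lemma num_reps_add:
  "num_reps \<beta> (n + k) x = (\<Sum>z\<in>X k. num_reps \<beta> k z * num_reps \<beta> n ((x - z) / \<beta> ^ k))"
proof -
  define join where "join = (\<lambda>(p, q). (fst p @ fst q, snd p @ snd q) :: int list \<times> int list)"
  define T where "T z = {p \<in> digit_pairs n. pair_sum p \<beta> = (x - z) / \<beta> ^ k} \<times> {q \<in> digit_pairs k. pair_sum q \<beta> = z}" for z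
  have sum_join: "pair_sum (join (p, q)) \<beta> = \<beta> ^ k * pair_sum p \<beta> + pair_sum q \<beta>"
    if "p \<in> digit_pairs n" "q \<in> digit_pairs k" for p q
    using that by (auto simp: join_def pair_sum_def digit_pairs_def word_sum_append)
  have finT: "finite (T z)" for z by (simp add: T_def finite_digit_pairs)
  have "bij_betw join (\<Union>z\<in>X k. T z) {p \<in> digit_pairs (n + k). pair_sum p \<beta> = x}"
    unfolding bij_betw_def
  proof
    show "inj_on join (\<Union>z\<in>X k. T z)"
      by (auto simp: inj_on_def T_def join_def digit_pairs_def)
    show "join ` (\<Union>z\<in>X k. T z) = {p \<in> digit_pairs (n + k). pair_sum p \<beta> = x}"
    proof (intro subset_antisym subsetI)
      fix y assume "y \<in> join ` (\<Union>z\<in>X k. T z)"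
      then obtain p q z where pq: "y = join (p, q)" "p \<in> digit_pairs n" "q \<in> digit_pairs k"
        "pair_sum p \<beta> = (x - z) / \<beta> ^ k" "pair_sum q \<beta> = z" by (auto simp: T_def)
      have "y \<in> digit_pairs (n + k)" using pq by (auto simp: join_def digit_pairs_def)
      moreover have "pair_sum y \<beta> = x" using sum_join[OF pq(2,3)] pq by simp
      ultimately show "y \<in> {p \<in> digit_pairs (n + k). pair_sum p \<beta> = x}" by simp
    next
      fix y assume y: "y \<in> {p \<in> digit_pairs (n + k). pair_sum p \<beta> = x}"
      define p q where "p = (take n (fst y), take n (snd y))" and "q = (drop n (fst y), drop n (snd y))"
      have "set (take n xs) \<subseteq> {0, 1}" "set (drop n xs) \<subseteq> {0, 1}" if "set xs \<subseteq> {0, 1}" for xs :: "int list"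
        using that set_take_subset[of n xs] set_drop_subset[of n xs] by auto
      then have pq: "p \<in> digit_pairs n" "q \<in> digit_pairs k" "y = join (p, q)"
        using y by (simp_all add: p_def q_def digit_pairs_def join_def mem_Times_iff)
      have x: "x = \<beta> ^ k * pair_sum p \<beta> + pair_sum q \<beta>" using sum_join[OF pq(1,2)] pq(3) y by simp
      have "q \<in> {q' \<in> digit_pairs k. pair_sum q' \<beta> = pair_sum q \<beta>}" using pq by simp
      moreover have "finite {q' \<in> digit_pairs k. pair_sum q' \<beta> = pair_sum q \<beta>}" using finite_digit_pairs by simp
      ultimately have "num_reps \<beta> k (pair_sum q \<beta>) > 0" unfolding num_reps_eq card_gt_0_iff by blast
      then have "pair_sum q \<beta> \<in> X k" by (simp add: num_reps_pos_iff)
      moreover have "(p, q) \<in> T (pair_sum q \<beta>)" using pq x by (simp add: T_def)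
      ultimately show "y \<in> join ` (\<Union>z\<in>X k. T z)" using pq(3) by blast
    qed
  qed
  from bij_betw_same_card[OF this] have "num_reps \<beta> (n + k) x = card (\<Union>z\<in>X k. T z)"
    by (simp add: num_reps_eq)
  also have "\<dots> = (\<Sum>z\<in>X k. card (T z))"
    by (intro card_UN_disjoint finite_X ballI finT impI) (auto simp: T_def)
  finally show ?thesis by (simp add: T_def card_cartesian_product num_reps_eq mult.commute)
qed

lemma spectrum_Zbeta: "x \<in> spectrum \<beta> \<Longrightarrow> x \<in> Zbeta" and emb_word_sum: "b \<in> conjs \<Longrightarrow> emb b (word_sum c \<beta>) = word_sum c b"
proof -
  have *: "word_sum c \<beta> \<in> Zbeta \<and> (b \<in> conjs \<longrightarrow> emb b (word_sum c \<beta>) = word_sum c b)" for c b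
  proof (induction c rule: rev_induct)
    case Nil
    then show ?case using Zbeta_int[of 0] emb_int[of b 0] by simp
  next
    case (snoc i c)
    have e: "word_sum (c @ [i]) z = z * word_sum c z + of_int i" for z :: "'a::field_char_0"
      by (simp add: word_sum_append word_sum_Cons)
    show ?case unfolding e
      using snoc Zbeta_beta Zbeta_int[of i] by (simp add: Zbeta_add Zbeta_mult emb_add emb_mult emb_beta emb_int)
  qed
  show "x \<in> spectrum \<beta> \<Longrightarrow> x \<in> Zbeta" using * by (auto simp: spectrum_def)
  show "b \<in> conjs \<Longrightarrow> emb b (word_sum c \<beta>) = word_sum c b" using * by blast
qed

lemma X_Zbeta: "x \<in> X n \<Longrightarrow> x \<in> Zbeta" using spectrumI spectrum_Zbeta by blast

lemma spectrum_bound: "x \<in> spectrum \<beta> \<Longrightarrow> b \<in> contr \<Longrightarrow> cmod (emb b x) \<le> 1 / (1 - cmod b)"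
  using emb_word_sum[OF contr_conj] norm_word_sum_contracting contr_lt1 by (auto simp: spectrum_def)

lemma contracted_eq: "x \<in> spectrum \<beta> \<Longrightarrow> contracted \<beta> x = (\<lambda>b\<in>contr. emb b x)"
proof -
  assume x: "x \<in> spectrum \<beta>"
  have e: "(\<lambda>b\<in>contr. word_sum c b) = (\<lambda>b\<in>contr. emb b (word_sum c \<beta>))" for c
    using emb_word_sum[OF contr_conj] by auto
  obtain c where c: "c \<in> words" "x = word_sum c \<beta>" using x by (auto simp: spectrum_def)
  show ?thesis unfolding contracted_def
    by (rule the_equality) (use c e in auto)
qed

lemma contracted_inj:
  assumes "x \<in> spectrum \<beta>" "y \<in> spectrum \<beta>" "contracted \<beta> x = contracted \<beta> y" shows "x = y"
proof -
  obtain b where b: "b \<in> contr" using contr_nonempty by blast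
  have "emb b x = emb b y" using assms b by (simp add: contracted_eq) (metis restrict_apply')
  then show ?thesis using emb_inj[OF contr_conj[OF b]] assms spectrum_Zbeta by blast
qed

end

locale growth = hyperbolic_number +
  fixes l :: real
  assumes growth: "is_growth_rate \<beta> l"
begin

abbreviation "\<mu> \<equiv> mu \<beta> l"

lemma l_gt1: "l > 1" using growth by (simp add: is_growth_rate_def)

lemma mu_pos: "x \<in> spectrum \<beta> \<Longrightarrow> \<mu> x > 0" using growth by (simp add: is_growth_rate_def)

lemma mu_lim: "(\<lambda>n. real (num_reps \<beta> n x) / l ^ n) \<longlonglongrightarrow> \<mu> x"
  and mu_outside: "x \<notin> spectrum \<beta> \<Longrightarrow> \<mu> x = 0"
proof -
  have z: "num_reps \<beta> n x = 0" if "x \<notin> spectrum \<beta>" for n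
    using that num_reps_pos_iff[of n x] spectrumI by blast
  show "x \<notin> spectrum \<beta> \<Longrightarrow> \<mu> x = 0" by (simp add: mu_def z)
  show "(\<lambda>n. real (num_reps \<beta> n x) / l ^ n) \<longlonglongrightarrow> \<mu> x"
  proof (cases "x \<in> spectrum \<beta>")
    case True
    then have "convergent (\<lambda>n. real (num_reps \<beta> n x) / l ^ n)" using growth by (simp add: is_growth_rate_def)
    then show ?thesis by (simp add: mu_def convergent_LIMSEQ_iff)
  next
    case False
    then show ?thesis by (simp add: z mu_def)
  qed
qed

lemma mu_nonneg: "\<mu> x \<ge> 0"
  using mu_pos[of x] mu_outside[of x] by (cases "x \<in> spectrum \<beta>") auto

text \<open>
  The limit of the splitting identity for representation numbers, divided by \<open>l ^ n\<close>.
\<close>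

lemma mu_step: "l ^ k * \<mu> x = (\<Sum>z\<in>X k. real (num_reps \<beta> k z) * \<mu> ((x - z) / \<beta> ^ k))"
proof -
  have l0: "l \<noteq> 0" using l_gt1 by simp
  have "(\<lambda>n. l ^ k * (real (num_reps \<beta> (n + k) x) / l ^ (n + k))) \<longlonglongrightarrow> l ^ k * \<mu> x"
    using LIMSEQ_ignore_initial_segment[OF mu_lim, of k x] by (intro tendsto_intros)
  moreover have "l ^ k * (real (num_reps \<beta> (n + k) x) / l ^ (n + k))
      = (\<Sum>z\<in>X k. real (num_reps \<beta> k z) * (real (num_reps \<beta> n ((x - z) / \<beta> ^ k)) / l ^ n))" for n
    using l0 num_reps_add[of n k x]
    by (simp add: power_add sum_divide_distrib sum_distrib_left field_simps)
  moreover have "(\<lambda>n. \<Sum>z\<in>X k. real (num_reps \<beta> k z) * (real (num_reps \<beta> n ((x - z) / \<beta> ^ k)) / l ^ n))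
      \<longlonglongrightarrow> (\<Sum>z\<in>X k. real (num_reps \<beta> k z) * \<mu> ((x - z) / \<beta> ^ k))"
    by (intro tendsto_intros mu_lim)
  ultimately show ?thesis using LIMSEQ_unique by simp
qed

end

section \<open>Gaps between parallel expansions\<close>

context hyperbolic_number begin

text \<open>
  Cylinders list the outermost map first, which carries the lowest digit of a sum; hence the
  reversal.
\<close>

abbreviation rsum :: "int list \<Rightarrow> real" where
  "rsum a \<equiv> word_sum (rev a) \<beta>"

lemma rsum_append: "rsum (a @ b) = rsum a + \<beta> ^ length a * rsum b"
  by (simp add: word_sum_append)

lemma rsum_Cons: "rsum (i # a) = of_int i + \<beta> * rsum a"
  using rsum_append[of "[i]" a] by (simp add: word_sum_Cons)

lemma rsum_X: "a \<in> words \<Longrightarrow> rsum a \<in> X (length a)"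
  by (intro XI) (auto simp: words_rev)

lemma X_1: "x \<in> X 1 \<longleftrightarrow> x \<in> of_int ` digits"
proof
  assume "x \<in> X 1"
  then obtain c where c: "c \<in> words" "length c = 1" "x = word_sum c \<beta>" by (auto simp: X_def)
  then obtain i where "c = [i]" by (auto simp: length_Suc_conv)
  then have "i \<in> digits" "x = of_int i" using c(1,3) by (simp_all add: words_Cons word_sum_Cons)
  then show "x \<in> of_int ` digits" by blast
next
  assume "x \<in> of_int ` digits"
  then obtain i where "i \<in> digits" "x = of_int i" by blast
  then show "x \<in> X 1" using XI[of "[i]" 1] by (simp add: words_Cons words_Nil word_sum_Cons)
qed

text \<open>
  If \<open>\<beta> ^ k * u + x = \<beta> ^ k * u' + y\<close> with \<open>x\<close> and \<open>y\<close> in \<open>X k\<close>, then \<open>u' - u\<close> is the number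
  \<open>(x - y) / \<beta> ^ k\<close>. These are the distances that can appear between two expansions of one number
  after the same number of digits has been removed from both.
\<close>

definition all_gaps :: "real set" where
  "all_gaps = {t. \<exists>k. \<exists>x\<in>X k. \<exists>y\<in>X k. \<beta> ^ k * t = x - y}"

text \<open>
  The bound holds whenever the gap separates a point of \<open>box\<close>, for instance a number in the spectrum,
  from a number in the spectrum (lemma \<open>alive_gap\<close>), and it makes the set finite.
\<close>

definition gaps :: "real set" where
  "gaps = {t \<in> all_gaps. \<forall>b\<in>contr. cmod (emb b t) \<le> 2 / (1 - cmod b)}"

text \<open>
  The ring elements whose contracting conjugates satisfy the bound that holds on the attractor.
\<close>

definition box :: "real set" where
  "box = {u \<in> Zbeta. \<forall>b\<in>contr. cmod (emb b u) \<le> 1 / (1 - cmod b)}"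

text \<open>
  Let \<open>x = rsum w + \<beta> ^ length w * u\<close>. Removing the digits of \<open>w\<close> from \<open>x\<close> leaves \<open>u\<close>, and the condition
  says that removing suitable \<open>length w\<close> digits from \<open>x + t\<close> leaves \<open>u + s\<close>. The number \<open>u\<close> cancels
  from this condition.
\<close>

definition reach :: "int list \<Rightarrow> real \<Rightarrow> real \<Rightarrow> bool" where
  "reach w t s \<longleftrightarrow> rsum w + t - \<beta> ^ length w * s \<in> X (length w)"

text \<open>
  For a suitable base word the two expansions can be made to coincide.
\<close>

definition mergeable :: "real \<Rightarrow> bool" where
  "mergeable t \<longleftrightarrow> (\<exists>w\<in>words. reach w t 0)"

lemma zero_gap: "0 \<in> gaps"
proof -
  have "0 \<in> all_gaps" unfolding all_gaps_def using X_zero[of 0] by (auto intro!: exI[of _ 0])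
  moreover have "cmod (emb b 0) \<le> 2 / (1 - cmod b)" if "b \<in> contr" for b
    using emb_int[OF contr_conj[OF that], of 0] contr_lt1[OF that] by simp
  ultimately show ?thesis by (simp add: gaps_def)
qed

lemma gaps_all: "t \<in> gaps \<Longrightarrow> t \<in> all_gaps" by (simp add: gaps_def)

lemma all_gapsE:
  assumes "t \<in> all_gaps" obtains k x y where "x \<in> X k" "y \<in> X k" "t = (x - y) / \<beta> ^ k"
  using assms unfolding all_gaps_def by (auto simp: field_simps)

lemma all_gaps_Zbeta: "t \<in> all_gaps \<Longrightarrow> t \<in> Zbeta"
  by (erule all_gapsE) (auto intro!: Zbeta_div Zbeta_diff intro: X_Zbeta)

lemma emb_X_expanding:
  assumes "b \<in> conjs" "cmod b > 1" "x \<in> X k" shows "cmod (emb b x) \<le> cmod b ^ k / (cmod b - 1)"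
proof -
  obtain c where "c \<in> words" "length c = k" "x = word_sum c \<beta>" using assms(3) by (auto simp: X_def)
  then show ?thesis using norm_word_sum_expanding[of c b] assms emb_word_sum[of b c] by simp
qed

text \<open>
  The contracting conjugates are bounded by definition, and the expanding ones because the division
  by \<open>\<beta> ^ k\<close> turns the sums of \<open>k\<close> digits into partial sums of a convergent geometric series.
\<close>

lemma finite_gaps: "finite gaps"
proof (rule finite_subset)
  define B where "B = (\<Sum>b\<in>conjs. 2 / \<bar>cmod b - 1\<bar>)"
  have B: "2 / \<bar>cmod b - 1\<bar> \<le> B" if "b \<in> conjs" for b
    unfolding B_def using finite_conjs that by (intro member_le_sum) auto
  show "gaps \<subseteq> {x \<in> Zbeta. \<forall>b\<in>conjs. cmod (emb b x) \<le> B}"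
  proof
    fix t assume t: "t \<in> gaps"
    have "cmod (emb b t) \<le> B" if b: "b \<in> conjs" for b
    proof (cases "cmod b < 1")
      case True
      then have "b \<in> contr" using b by (simp add: contracting_def)
      then have "cmod (emb b t) \<le> 2 / (1 - cmod b)" using t by (simp add: gaps_def)
      then show ?thesis using B[OF b] True by simp
    next
      case False
      then have b1: "cmod b > 1" using conj_norm[OF b] by simp
      obtain k x y where t': "x \<in> X k" "y \<in> X k" "t = (x - y) / \<beta> ^ k" using gaps_all[OF t] by (rule all_gapsE)
      have "emb b t = (emb b x - emb b y) / b ^ k"
        using t' X_Zbeta b by (simp add: emb_div emb_diff Zbeta_diff)
      then have "cmod (emb b t) = cmod (emb b x - emb b y) / cmod b ^ k" by (simp add: norm_divide norm_power)
      also have "\<dots> \<le> (cmod (emb b x) + cmod (emb b y)) / cmod b ^ k"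
        by (intro divide_right_mono norm_triangle_ineq4) simp
      also have "\<dots> \<le> (cmod b ^ k / (cmod b - 1) + cmod b ^ k / (cmod b - 1)) / cmod b ^ k"
        by (intro divide_right_mono add_mono emb_X_expanding b b1 t') simp
      also have "\<dots> = 2 / \<bar>cmod b - 1\<bar>"
      proof -
        have "(c / d + c / d) / c = 2 / d" if "c \<noteq> 0" for c d :: real
          using that by (cases "d = 0") (auto simp: field_simps)
        moreover have "cmod b ^ k \<noteq> 0" using b1 by auto
        ultimately show ?thesis using b1 by simp
      qed
      finally show ?thesis using B[OF b] by simp
    qed
    then show "t \<in> {x \<in> Zbeta. \<forall>b\<in>conjs. cmod (emb b x) \<le> B}"
      using all_gaps_Zbeta gaps_all t by blast
  qed
qed (rule finite_bounded_conjugates)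

lemma spectrum_box: "x \<in> spectrum \<beta> \<Longrightarrow> x \<in> box"
  using spectrum_Zbeta spectrum_bound by (auto simp: box_def)

lemma box_word: "u \<in> box \<Longrightarrow> a \<in> words \<Longrightarrow> rsum a + \<beta> ^ length a * u \<in> box"
proof (induction a)
  case (Cons i a)
  define y where "y = rsum a + \<beta> ^ length a * u"
  have y: "y \<in> box" using Cons by (simp add: y_def words_Cons)
  have e: "rsum (i # a) + \<beta> ^ length (i # a) * u = of_int i + \<beta> * y"
    unfolding rsum_Cons y_def by (simp add: algebra_simps)
  have i: "i \<in> digits" using Cons.prems by (simp add: words_Cons)
  have yL: "y \<in> Zbeta" using y by (simp add: box_def)
  have "cmod (emb b (of_int i + \<beta> * y)) \<le> 1 / (1 - cmod b)" if b: "b \<in> contr" for b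
  proof -
    have "cmod (emb b (of_int i + \<beta> * y)) \<le> cmod (of_int i) + cmod b * cmod (emb b y)"
      using yL contr_conj[OF b] norm_triangle_ineq[of "of_int i" "b * emb b y"]
      by (simp add: emb_add emb_mult emb_int emb_beta Zbeta_int Zbeta_mult Zbeta_beta norm_mult)
    also have "\<dots> \<le> 1 + cmod b * (1 / (1 - cmod b))"
      using y b i by (intro add_mono mult_left_mono) (auto simp: box_def)
    also have "\<dots> = 1 / (1 - cmod b)" using contr_lt1[OF b] by (simp add: field_simps)
    finally show ?thesis .
  qed
  then show ?case unfolding e using yL by (simp add: box_def Zbeta_add Zbeta_int Zbeta_mult Zbeta_beta)
qed simp

lemma alive_gap:
  assumes "u \<in> box" "s \<in> all_gaps" "u + s \<in> spectrum \<beta>" shows "s \<in> gaps"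
proof -
  have "cmod (emb b s) \<le> 2 / (1 - cmod b)" if b: "b \<in> contr" for b
  proof -
    have "emb b s = emb b ((u + s) - u)" by simp
    also have "\<dots> = emb b (u + s) - emb b u"
      using assms(1) spectrum_Zbeta[OF assms(3)] contr_conj[OF b] by (intro emb_diff) (auto simp: box_def)
    finally have "cmod (emb b s) \<le> cmod (emb b (u + s)) + cmod (emb b u)" by (simp add: norm_triangle_ineq4)
    also have "\<dots> \<le> 1 / (1 - cmod b) + 1 / (1 - cmod b)"
      using assms(1) b by (intro add_mono spectrum_bound[OF assms(3) b]) (auto simp: box_def)
    finally show ?thesis by simp
  qed
  then show ?thesis using assms(2) by (simp add: gaps_def)
qed

lemma reach_append:
  assumes "reach w t s" "reach w' s r" shows "reach (w @ w') t r"
proof -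
  have "\<beta> ^ length w * (rsum w' + s - \<beta> ^ length w' * r) + (rsum w + t - \<beta> ^ length w * s)
      \<in> X (length w' + length w)"
    using assms by (intro X_concat) (simp_all add: reach_def)
  also have "\<beta> ^ length w * (rsum w' + s - \<beta> ^ length w' * r) + (rsum w + t - \<beta> ^ length w * s)
      = rsum (w @ w') + t - \<beta> ^ length (w @ w') * r"
    unfolding rsum_append by (simp add: algebra_simps power_add)
  finally show ?thesis by (simp add: reach_def add.commute)
qed

lemma reach_appendE:
  assumes "reach (w @ w') t r" obtains s where "reach w t s" "reach w' s r"
proof -
  have "rsum (w @ w') + t - \<beta> ^ length (w @ w') * r \<in> X (length w' + length w)"
    using assms by (simp add: reach_def add.commute)
  then obtain x y where xy: "x \<in> X (length w')" "y \<in> X (length w)"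
    "rsum (w @ w') + t - \<beta> ^ length (w @ w') * r = \<beta> ^ length w * x + y" by (rule X_split)
  define s where "s = (rsum w + t - y) / \<beta> ^ length w"
  have y: "y = rsum w + t - \<beta> ^ length w * s" by (simp add: s_def)
  have "\<beta> ^ length w * x = \<beta> ^ length w * (rsum w' + s - \<beta> ^ length w' * r)"
    using xy(3) y unfolding rsum_append by (simp add: algebra_simps power_add)
  then have "x = rsum w' + s - \<beta> ^ length w' * r" by simp
  then show ?thesis using that[of s] xy y by (simp add: reach_def)
qed

lemma reach_zero: "w \<in> words \<Longrightarrow> reach w 0 0"
  by (simp add: reach_def rsum_X)

lemma reach_all_gaps:
  assumes "t \<in> all_gaps" "w \<in> words" "reach w t s" shows "s \<in> all_gaps"
proof -
  obtain k x y where t: "x \<in> X k" "y \<in> X k" "t = (x - y) / \<beta> ^ k" using assms(1) by (rule all_gapsE)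
  define n where "n = length w"
  define z where "z = rsum w + t - \<beta> ^ n * s"
  have z: "z \<in> X n" using assms(3) by (simp add: z_def n_def reach_def)
  have "\<beta> ^ k * rsum w + x \<in> X (n + k)" "\<beta> ^ k * z + y \<in> X (n + k)"
    using X_concat[OF rsum_X[OF assms(2)] t(1)] X_concat[OF z t(2)] by (simp_all add: n_def)
  moreover have "\<beta> ^ (n + k) * s = (\<beta> ^ k * rsum w + x) - (\<beta> ^ k * z + y)"
  proof -
    have "\<beta> ^ k * t = x - y" using t(3) by simp
    then show ?thesis by (simp add: z_def power_add algebra_simps)
  qed
  ultimately show ?thesis unfolding all_gaps_def by blast
qed

text \<open>
  One step backwards multiplies a conjugate by \<open>b\<close> and adds a difference of two digits, and
  \<open>2 / (1 - cmod b)\<close> is the fixed point of \<open>\<lambda>r. cmod b * r + 2\<close>.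
\<close>

lemma reach_gaps_back:
  assumes "s \<in> gaps" "t \<in> all_gaps" "w \<in> words" "reach w t s" shows "t \<in> gaps"
  using assms(2-4)
proof (induction w arbitrary: t)
  case Nil
  then have "t = s" by (simp add: reach_def X_0)
  then show ?case using assms(1) by simp
next
  case (Cons i w)
  have iw: "[i] \<in> words" "w \<in> words" "i \<in> digits"
    using Cons.prems(2) unfolding words_Cons by (auto simp: words_Nil)
  have "reach ([i] @ w) t s" using Cons.prems by simp
  then obtain r where r: "reach [i] t r" "reach w r s" by (rule reach_appendE)
  have rg: "r \<in> gaps" using Cons.IH[OF reach_all_gaps[OF Cons.prems(1) iw(1) r(1)] iw(2) r(2)] .
  have "of_int i + t - \<beta> * r \<in> X 1" using r(1) by (simp add: reach_def word_sum_Cons)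
  then obtain j where j: "j \<in> digits" "of_int i + t - \<beta> * r = of_int j"
    unfolding X_1 by blast
  have t: "t = \<beta> * r + of_int (j - i)" using j by simp
  have rL: "r \<in> Zbeta" using rg gaps_all all_gaps_Zbeta by blast
  have "cmod (emb b t) \<le> 2 / (1 - cmod b)" if b: "b \<in> contr" for b
  proof -
    have "cmod (emb b t) \<le> cmod b * cmod (emb b r) + cmod (of_int (j - i))"
      unfolding t using rL contr_conj[OF b] norm_triangle_ineq[of "b * emb b r" "of_int (j - i)"]
      by (simp only: emb_add emb_mult emb_int emb_beta Zbeta_int Zbeta_mult Zbeta_beta norm_mult)
    also have "\<dots> \<le> cmod b * (2 / (1 - cmod b)) + 2"
      using rg b j(1) iw(3) by (intro add_mono mult_left_mono) (auto simp: gaps_def)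
    also have "\<dots> = 2 / (1 - cmod b)" using contr_lt1[OF b] by (simp add: field_simps)
    finally show ?thesis .
  qed
  then show ?case using Cons.prems(1) by (simp add: gaps_def)
qed

lemma reach_from_zero:
  assumes "s \<in> all_gaps" obtains w where "w \<in> words" "reach w 0 s"
proof -
  obtain k x y where s: "x \<in> X k" "y \<in> X k" "s = (x - y) / \<beta> ^ k" using assms by (rule all_gapsE)
  then obtain c where c: "c \<in> words" "length c = k" "x = word_sum c \<beta>" by (auto simp: X_def)
  show ?thesis
  proof (rule that[of "rev c"])
    have "rsum (rev c) + 0 - \<beta> ^ k * s = y" using s(3) c(3) by simp
    then show "reach (rev c) 0 s" using s(2) c(2) by (simp add: reach_def)
  qed (simp add: words_rev c)
qed

text \<open>
  With a word for \<open>y\<close> as base word, all digits can be removed from \<open>y\<close> and from \<open>x\<close>, and \<open>0\<close> is left of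
  both.
\<close>

lemma difference_mergeable:
  assumes "x \<in> spectrum \<beta>" "y \<in> spectrum \<beta>" shows "mergeable (x - y)"
proof -
  obtain m n where "x \<in> X m" "y \<in> X n" using assms by (auto simp: spectrum_eq)
  then have xy: "x \<in> X (max m n)" "y \<in> X (max m n)" by (auto intro: X_mono[rotated])
  then obtain c where c: "c \<in> words" "length c = max m n" "y = word_sum c \<beta>" by (auto simp: X_def)
  then have "reach (rev c) (x - y) 0" using xy by (simp add: reach_def)
  then show ?thesis using c(1) words_rev unfolding mergeable_def by blast
qed

lemma spectrum_pull:
  assumes "rsum w + \<beta> ^ length w * u + t \<in> spectrum \<beta>"
  obtains s where "reach w t s" "u + s \<in> spectrum \<beta>"
proof -
  obtain y z where yz: "y \<in> spectrum \<beta>" "z \<in> X (length w)"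
    "rsum w + \<beta> ^ length w * u + t = \<beta> ^ length w * y + z"
    using assms by (rule spectrum_split)
  have "rsum w + t - \<beta> ^ length w * (y - u) = z" using yz(3) by (simp add: algebra_simps)
  then show ?thesis using that[of "y - u"] yz by (simp add: reach_def)
qed

lemma spectrum_push:
  assumes "reach w t s" "u + s \<in> spectrum \<beta>"
  shows "rsum w + \<beta> ^ length w * u + t \<in> spectrum \<beta>"
proof -
  have "\<beta> ^ length w * (u + s) + (rsum w + t - \<beta> ^ length w * s) \<in> spectrum \<beta>"
    using assms by (intro spectrum_concat) (simp_all add: reach_def)
  then show ?thesis by (simp add: algebra_simps)
qed

lemma pull_gap:
  assumes "rsum w + \<beta> ^ length w * u + t \<in> spectrum \<beta>" "w \<in> words" "u \<in> box" "t \<in> all_gaps"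
  obtains s where "reach w t s" "u + s \<in> spectrum \<beta>" "s \<in> gaps"
  using spectrum_pull[OF assms(1)] alive_gap reach_all_gaps assms(2-4) by metis

text \<open>
  Prepending a word to \<open>v\<close> enlarges the set of gaps that are reached from \<open>0\<close>, because \<open>0\<close> reaches \<open>0\<close>
  along every word, and it shrinks the set of gaps that are reached from any gap at all. If \<open>s\<close> is
  reached from a gap \<open>t\<close>, then prepending a word that leads from \<open>0\<close> to \<open>t\<close> puts \<open>s\<close> into the first set.
  There are only finitely many gaps, so they can be treated one after another.
\<close>

lemma column_word:
  obtains v where "v \<in> words" "v \<noteq> []"
    "\<And>t s. \<lbrakk>t \<in> gaps; s \<in> gaps; reach v t s\<rbrakk> \<Longrightarrow> reach v 0 s"
proof -
  have "\<exists>v\<in>words. v \<noteq> [] \<and> (\<forall>s\<in>F. (\<exists>t\<in>gaps. reach v t s) \<longrightarrow> reach v 0 s)"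
    if "finite F" "F \<subseteq> gaps" for F
    using that
  proof (induction F rule: finite_induct)
    case empty
    show ?case by (intro bexI[of _ "[0]"]) (auto simp: words_def)
  next
    case (insert s F)
    then obtain v where v: "v \<in> words" "v \<noteq> []"
      "\<And>s t. s \<in> F \<Longrightarrow> t \<in> gaps \<Longrightarrow> reach v t s \<Longrightarrow> reach v 0 s" by auto
    show ?case
    proof (cases "\<exists>t\<in>gaps. reach v t s")
      case False
      then show ?thesis using v by (intro bexI[of _ v]) auto
    next
      case True
      then obtain t where t: "t \<in> gaps" "reach v t s" by blast
      obtain w where w: "w \<in> words" "reach w 0 t" using reach_from_zero[OF gaps_all[OF t(1)]] .
      have "reach (w @ v) 0 r" if r: "r \<in> F" and q: "q \<in> gaps" "reach (w @ v) q r" for r q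
      proof -
        obtain p where p: "reach w q p" "reach v p r" using q(2) by (rule reach_appendE)
        have "p \<in> all_gaps" using reach_all_gaps[OF gaps_all[OF q(1)] w(1) p(1)] .
        then have "p \<in> gaps" using reach_gaps_back[of r p v] p(2) v(1) r insert.prems by auto
        then show ?thesis using v(3)[OF r _ p(2)] reach_append[OF reach_zero[OF w(1)]] by blast
      qed
      moreover have "reach (w @ v) 0 s" using reach_append[OF w(2) t(2)] .
      ultimately show ?thesis using v(1,2) w(1)
        by (intro bexI[of _ "w @ v"]) (auto simp: words_append)
    qed
  qed
  from this[OF finite_gaps] show ?thesis using that by blast
qed

text \<open>
  The gaps \<open>t\<close> are again treated one after another, now by appending words. If \<open>t\<close> reaches a mergeable
  gap, then a word that leads from there to \<open>0\<close> is appended, and \<open>0\<close> stays reachable from then on. If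
  it reaches none, then this persists, because a gap from which a mergeable gap can be reached is
  mergeable itself.
\<close>

lemma row_word:
  obtains w where "w \<in> words"
    "\<And>t s. \<lbrakk>t \<in> gaps; s \<in> gaps; reach w t s; mergeable s\<rbrakk> \<Longrightarrow> reach w t 0"
proof -
  have "\<exists>w\<in>words. \<forall>t\<in>F. (\<exists>s\<in>gaps. reach w t s \<and> mergeable s) \<longrightarrow> reach w t 0"
    if "finite F" "F \<subseteq> gaps" for F
    using that
  proof (induction F rule: finite_induct)
    case empty
    show ?case using words_Nil by blast
  next
    case (insert t F)
    then obtain w where w: "w \<in> words"
      "\<And>s t. t \<in> F \<Longrightarrow> s \<in> gaps \<Longrightarrow> reach w t s \<Longrightarrow> mergeable s \<Longrightarrow> reach w t 0" by auto
    show ?case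
    proof (cases "\<exists>s\<in>gaps. reach w t s \<and> mergeable s")
      case False
      then show ?thesis using w by (intro bexI[of _ w]) auto
    next
      case True
      then obtain s v where s: "s \<in> gaps" "reach w t s" "v \<in> words" "reach v s 0"
        by (auto simp: mergeable_def)
      have "reach (w @ v) r 0" if r: "r \<in> F" and q: "q \<in> gaps" "reach (w @ v) r q" "mergeable q" for r q
      proof -
        obtain p where p: "reach w r p" "reach v p q" using q(2) by (rule reach_appendE)
        have "r \<in> all_gaps" using r insert.prems gaps_all by blast
        then have "p \<in> all_gaps" using reach_all_gaps[OF _ w(1) p(1)] by blast
        then have pg: "p \<in> gaps" using reach_gaps_back[OF q(1) _ s(3) p(2)] by blast
        obtain v' where "v' \<in> words" "reach v' q 0" using q(3) by (auto simp: mergeable_def)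
        then have "mergeable p"
          using reach_append[OF p(2)] s(3) unfolding mergeable_def
          by (intro bexI[of _ "v @ v'"]) (auto simp: words_append)
        then have "reach w r 0" using w(2)[OF r pg p(1)] by blast
        then show ?thesis using reach_append reach_zero[OF s(3)] by blast
      qed
      moreover have "reach (w @ v) t 0" using reach_append[OF s(2,4)] .
      ultimately show ?thesis using w(1) s(3)
        by (intro bexI[of _ "w @ v"]) (auto simp: words_append)
    qed
  qed
  from this[OF finite_gaps] show ?thesis using that by blast
qed

end

section \<open>Contraction of ratios along copies of a merging word\<close>

text \<open>
  Along the word \<open>w = w1 @ v\<close> every gap that matters can pass through \<open>0\<close> between \<open>w1\<close> and \<open>v\<close>, and from
  there it can go wherever any gap can go. The matrix of \<open>w\<close> is therefore positive on a set of
  rows times a set of columns, and all its other entries are irrelevant or zero.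
\<close>

locale merging = growth +
  fixes w1 v :: "int list"
  assumes w1: "w1 \<in> words" and v: "v \<in> words" "v \<noteq> []"
    and column: "\<And>t s. \<lbrakk>t \<in> gaps; s \<in> gaps; reach v t s\<rbrakk> \<Longrightarrow> reach v 0 s"
    and row: "\<And>t s. \<lbrakk>t \<in> gaps; s \<in> gaps; reach w1 t s; mergeable s\<rbrakk> \<Longrightarrow> reach w1 t 0"
begin

definition w :: "int list" where "w = w1 @ v"

definition K :: real where "K = 4 ^ length w"

text \<open>
  Equivalently, the vector of the values \<open>\<mu> (x + t)\<close> over all gaps \<open>t\<close> is not zero.
\<close>

definition alive :: "real \<Rightarrow> bool" where
  "alive x \<longleftrightarrow> (\<exists>t\<in>gaps. x + t \<in> spectrum \<beta>)"

definition sandwich :: "real \<Rightarrow> real \<Rightarrow> real \<Rightarrow> real \<Rightarrow> bool" where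
  "sandwich m M x x' \<longleftrightarrow> (\<forall>t\<in>gaps. m * \<mu> (x' + t) \<le> \<mu> (x + t) \<and> \<mu> (x + t) \<le> M * \<mu> (x' + t))"

text \<open>
  The number from which \<open>u\<close> is left when the digits of \<open>a\<close> are removed.
\<close>

abbreviation place :: "int list \<Rightarrow> real \<Rightarrow> real" where
  "place a u \<equiv> rsum a + \<beta> ^ length a * u"

abbreviation entry :: "int list \<Rightarrow> real \<Rightarrow> real \<Rightarrow> real" where
  "entry a t s \<equiv> real (num_reps \<beta> (length a) (rsum a + t - \<beta> ^ length a * s))"

definition columns :: "real set" where
  "columns = {s \<in> gaps. \<exists>t\<in>gaps. reach v t s}"

lemma w_words: "w \<in> words" using w1 v by (simp add: w_def words_append)
lemma w_ne: "w \<noteq> []" using v by (simp add: w_def)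

lemma K_ge: "K \<ge> 4"
proof -
  have "1 \<le> length w" using w_ne by (cases w) auto
  from power_increasing[OF this, of "4::real"] show ?thesis by (simp add: K_def)
qed

lemma place_append: "place (a @ b) u = place a (place b u)"
  unfolding rsum_append by (simp add: algebra_simps power_add)

text \<open>
  The coefficients do not involve \<open>u\<close>. Only gaps contribute, since for the other summands of
  \<open>mu_step\<close> the number \<open>u + s\<close> is outside the spectrum.
\<close>

lemma mu_place:
  assumes "a \<in> words" "u \<in> box" "t \<in> all_gaps"
  shows "l ^ length a * \<mu> (place a u + t) = (\<Sum>s\<in>gaps. entry a t s * \<mu> (u + s))"
proof -
  define n where "n = length a"
  define x where "x = place a u + t"
  have arg: "(x - z) / \<beta> ^ n = u + (rsum a + t - z) / \<beta> ^ n" for z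
    by (simp add: x_def n_def field_simps)
  have "l ^ n * \<mu> x = (\<Sum>z\<in>X n. real (num_reps \<beta> n z) * \<mu> ((x - z) / \<beta> ^ n))" by (rule mu_step)
  also have "\<dots> = (\<Sum>s\<in>gaps. entry a t s * \<mu> (u + s))"
  proof (rule sum.reindex_bij_witness_not_neutral[where
        i = "\<lambda>s. rsum a + t - \<beta> ^ n * s" and j = "\<lambda>z. (rsum a + t - z) / \<beta> ^ n" and
        S' = "{z \<in> X n. \<mu> ((x - z) / \<beta> ^ n) = 0}" and
        T' = "{s \<in> gaps. entry a t s = 0 \<or> \<mu> (u + s) = 0}"])
    show "finite {z \<in> X n. \<mu> ((x - z) / \<beta> ^ n) = 0}" using finite_X by simp
    show "finite {s \<in> gaps. entry a t s = 0 \<or> \<mu> (u + s) = 0}" using finite_gaps by simp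
  next
    fix z assume z: "z \<in> X n - {z \<in> X n. \<mu> ((x - z) / \<beta> ^ n) = 0}"
    define s where "s = (rsum a + t - z) / \<beta> ^ n"
    show "rsum a + t - \<beta> ^ n * ((rsum a + t - z) / \<beta> ^ n) = z" by simp
    have zz: "rsum a + t - \<beta> ^ n * s = z" by (simp add: s_def)
    have nz: "\<mu> (u + s) \<noteq> 0" using z arg by (simp add: s_def)
    then have sp: "u + s \<in> spectrum \<beta>" using mu_outside by blast
    have r: "reach a t s" using zz z by (simp add: reach_def n_def)
    then have "s \<in> gaps" using alive_gap[OF assms(2) _ sp] reach_all_gaps[OF assms(3,1)] by blast
    moreover have "entry a t s \<noteq> 0" using zz z num_reps_pos_iff[of n z] by (simp add: n_def)
    ultimately show "(rsum a + t - z) / \<beta> ^ n \<in> gaps - {s \<in> gaps. entry a t s = 0 \<or> \<mu> (u + s) = 0}"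
      using nz by (simp add: s_def)
  next
    fix s assume s: "s \<in> gaps - {s \<in> gaps. entry a t s = 0 \<or> \<mu> (u + s) = 0}"
    show "(rsum a + t - (rsum a + t - \<beta> ^ n * s)) / \<beta> ^ n = s" by simp
    have "(x - (rsum a + t - \<beta> ^ n * s)) / \<beta> ^ n = u + s" unfolding arg by simp
    moreover have "rsum a + t - \<beta> ^ n * s \<in> X n" using s num_reps_pos_iff[of n "rsum a + t - \<beta> ^ n * s"]
      by (auto simp: n_def)
    ultimately show "rsum a + t - \<beta> ^ n * s \<in> X n - {z \<in> X n. \<mu> ((x - z) / \<beta> ^ n) = 0}"
      using s by simp
  next
    fix z assume "z \<in> X n"
    show "entry a t ((rsum a + t - z) / \<beta> ^ n) * \<mu> (u + (rsum a + t - z) / \<beta> ^ n)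
        = real (num_reps \<beta> n z) * \<mu> ((x - z) / \<beta> ^ n)"
      unfolding arg by (simp add: n_def)
  qed auto
  finally show ?thesis by (simp add: x_def n_def)
qed

lemma sandwich_place:
  assumes "sandwich m M u u'" "a \<in> words" "u \<in> box" "u' \<in> box"
  shows "sandwich m M (place a u) (place a u')"
  unfolding sandwich_def
proof
  fix t assume t: "t \<in> gaps"
  have l: "l ^ length a > 0" using l_gt1 by simp
  have "m * (l ^ length a * \<mu> (place a u' + t)) \<le> l ^ length a * \<mu> (place a u + t)"
    unfolding mu_place[OF assms(2,3) gaps_all[OF t]] mu_place[OF assms(2,4) gaps_all[OF t]] sum_distrib_left
  proof (rule sum_mono)
    fix s assume "s \<in> gaps"
    then have "entry a t s * (m * \<mu> (u' + s)) \<le> entry a t s * \<mu> (u + s)"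
      using assms(1) by (intro mult_left_mono) (auto simp: sandwich_def)
    then show "m * (entry a t s * \<mu> (u' + s)) \<le> entry a t s * \<mu> (u + s)" by (simp add: mult.left_commute)
  qed
  moreover have "l ^ length a * \<mu> (place a u + t) \<le> M * (l ^ length a * \<mu> (place a u' + t))"
    unfolding mu_place[OF assms(2,3) gaps_all[OF t]] mu_place[OF assms(2,4) gaps_all[OF t]] sum_distrib_left
  proof (rule sum_mono)
    fix s assume "s \<in> gaps"
    then have "entry a t s * \<mu> (u + s) \<le> entry a t s * (M * \<mu> (u' + s))"
      using assms(1) by (intro mult_left_mono) (auto simp: sandwich_def)
    then show "entry a t s * \<mu> (u + s) \<le> M * (entry a t s * \<mu> (u' + s))" by (simp add: mult.left_commute)
  qed
  ultimately have "l ^ length a * (m * \<mu> (place a u' + t)) \<le> l ^ length a * \<mu> (place a u + t)"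
    "l ^ length a * \<mu> (place a u + t) \<le> l ^ length a * (M * \<mu> (place a u' + t))"
    by (simp_all add: mult.left_commute)
  then show "m * \<mu> (place a u' + t) \<le> \<mu> (place a u + t) \<and> \<mu> (place a u + t) \<le> M * \<mu> (place a u' + t)"
    using l by (simp add: mult_le_cancel_left_pos)
qed

text \<open>
  The gap \<open>t\<close> becomes \<open>s1\<close> along \<open>w1\<close> and then \<open>s\<close> along \<open>v\<close>. By the property of \<open>v\<close>, the gap \<open>0\<close> reaches
  \<open>s\<close> as well, so \<open>place v u\<close> itself lies in the spectrum, whether or not \<open>u\<close> does. Hence \<open>s1\<close> is a
  difference of two numbers in the spectrum and is mergeable, and the property of \<open>w1\<close> applies.
\<close>

lemma alive_row:
  assumes "u \<in> box" "t \<in> gaps" "place w u + t \<in> spectrum \<beta>"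
  shows "reach w1 t 0" "place v u \<in> spectrum \<beta>"
proof -
  have y: "place v u \<in> box" using box_word[OF assms(1) v(1)] .
  have "place w1 (place v u) + t \<in> spectrum \<beta>" using assms(3) unfolding w_def place_append .
  then obtain s1 where s1: "reach w1 t s1" "place v u + s1 \<in> spectrum \<beta>" "s1 \<in> gaps"
    using pull_gap[OF _ w1 y gaps_all[OF assms(2)]] by blast
  obtain s where s: "reach v s1 s" "u + s \<in> spectrum \<beta>" "s \<in> gaps"
    using pull_gap[OF s1(2) v(1) assms(1) gaps_all[OF s1(3)]] .
  have "place v u + 0 \<in> spectrum \<beta>" using spectrum_push[OF column[OF s1(3) s(3,1)] s(2)] .
  then show pl: "place v u \<in> spectrum \<beta>" by simp
  have "mergeable s1" using difference_mergeable[OF s1(2) pl] by simp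
  then show "reach w1 t 0" using row[OF assms(2) s1(3,1)] by blast
qed

text \<open>
  The gap \<open>t\<close> reaches \<open>0\<close> along \<open>w1\<close>, and from \<open>0\<close> the word \<open>v\<close> leads to every column.
\<close>

lemma entry_w:
  assumes "t \<in> gaps" "reach w1 t 0" "s \<in> gaps"
  shows "s \<in> columns \<Longrightarrow> entry w t s \<ge> 1" "s \<notin> columns \<Longrightarrow> entry w t s = 0" "entry w t s \<le> K"
proof -
  have r: "entry w t s > 0 \<longleftrightarrow> reach w t s" using num_reps_pos_iff by (simp add: reach_def)
  show "entry w t s \<ge> 1" if "s \<in> columns"
  proof -
    have "reach v 0 s" using that column by (auto simp: columns_def)
    then have "reach w t s" unfolding w_def using reach_append[OF assms(2)] by blast
    then show ?thesis using r by simp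
  qed
  show "entry w t s = 0" if "s \<notin> columns"
  proof (rule ccontr)
    assume "entry w t s \<noteq> 0"
    then have "reach w t s" using r by simp
    then obtain s1 where s1: "reach w1 t s1" "reach v s1 s" unfolding w_def by (rule reach_appendE)
    have "s1 \<in> gaps"
      using reach_gaps_back[OF assms(3) _ v(1) s1(2)] reach_all_gaps[OF gaps_all[OF assms(1)] w1 s1(1)] by blast
    then show False using s1 assms(3) that by (auto simp: columns_def)
  qed
  have "real (num_reps \<beta> (length w) x) \<le> real (4 ^ length w)" for x
    using num_reps_le by (simp only: of_nat_le_iff)
  then show "entry w t s \<le> K" unfolding K_def by simp
qed

lemma block_bounds:
  assumes t: "t \<in> gaps" "reach w1 t 0" and h: "\<And>s. s \<in> columns \<Longrightarrow> h s \<ge> 0"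
  shows "(\<Sum>s\<in>columns. h s) \<le> (\<Sum>s\<in>gaps. entry w t s * h s)"
    "(\<Sum>s\<in>gaps. entry w t s * h s) \<le> K * (\<Sum>s\<in>columns. h s)"
proof -
  have sub: "columns \<subseteq> gaps" by (auto simp: columns_def)
  have e: "(\<Sum>s\<in>gaps. entry w t s * h s) = (\<Sum>s\<in>columns. entry w t s * h s)"
    using entry_w(2)[OF t] by (intro sum.mono_neutral_right finite_gaps sub) auto
  show "(\<Sum>s\<in>columns. h s) \<le> (\<Sum>s\<in>gaps. entry w t s * h s)"
    unfolding e using entry_w(1)[OF t] sub h mult_right_mono[of 1] by (intro sum_mono) fastforce
  show "(\<Sum>s\<in>gaps. entry w t s * h s) \<le> K * (\<Sum>s\<in>columns. h s)"
    unfolding e sum_distrib_left using entry_w(3)[OF t] sub h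
    by (intro sum_mono mult_right_mono) auto
qed

lemma dead_row: "u \<in> box \<Longrightarrow> t \<in> gaps \<Longrightarrow> \<not> reach w1 t 0 \<Longrightarrow> \<mu> (place w u + t) = 0"
  using alive_row(1) mu_outside by blast

text \<open>
  The relevant entries of the matrix of \<open>w\<close> lie between \<open>1\<close> and \<open>K\<close>, so up to the factor \<open>K\<close> every
  nonzero coordinate is the sum over the columns.
\<close>

lemma sandwich_first:
  assumes u: "u \<in> box" "u' \<in> box" and al: "alive (place w u)" "alive (place w u')"
  obtains m M where "m > 0" "m \<le> M" "M - m \<le> K\<^sup>2 * m" "sandwich m M (place w u) (place w u')"
proof -
  define e where "e x = (\<Sum>s\<in>columns. \<mu> (x + s))" for x
  define ll where "ll = l ^ length w"
  have ll: "ll > 0" using l_gt1 by (simp add: ll_def)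
  have K0: "K > 0" using K_ge by simp
  have bnd: "e x \<le> ll * \<mu> (place w x + t)" "ll * \<mu> (place w x + t) \<le> K * e x"
    if "x \<in> box" "t \<in> gaps" "reach w1 t 0" for x t
    using block_bounds[OF that(2,3), of "\<lambda>s. \<mu> (x + s)"] mu_nonneg
      mu_place[OF w_words that(1) gaps_all[OF that(2)]] by (simp_all add: e_def ll_def)
  have pos: "e x > 0" if "x \<in> box" and ax: "alive (place w x)" for x
  proof -
    obtain t where t: "t \<in> gaps" "place w x + t \<in> spectrum \<beta>" using ax by (auto simp: alive_def)
    have "0 < ll * \<mu> (place w x + t)" using ll mu_pos[OF t(2)] by simp
    also have "\<dots> \<le> K * e x" using bnd(2)[OF that(1) t(1) alive_row(1)[OF that(1) t]] .
    finally show ?thesis using K0 by (simp add: zero_less_mult_iff)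
  qed
  have e0: "e u > 0" "e u' > 0" using pos u al by auto
  define m where "m = e u / (K * e u')"
  define M where "M = K * e u / e u'"
  have mM: "M = K\<^sup>2 * m" using K0 e0 by (simp add: M_def m_def power2_eq_square)
  have "m > 0" using e0 K0 by (simp add: m_def)
  moreover from this have "m \<le> M"
    using mult_right_mono[of 1 "K\<^sup>2" m] K_ge one_le_power[of K 2] by (simp add: mM)
  moreover have "sandwich m M (place w u) (place w u')"
    unfolding sandwich_def
  proof
    fix t assume t: "t \<in> gaps"
    show "m * \<mu> (place w u' + t) \<le> \<mu> (place w u + t) \<and> \<mu> (place w u + t) \<le> M * \<mu> (place w u' + t)"
    proof (cases "reach w1 t 0")
      case False
      then show ?thesis using dead_row u t by simp
    next
      case True
      have "m * (ll * \<mu> (place w u' + t)) \<le> m * (K * e u')"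
        using bnd(2)[OF u(2) t True] \<open>m > 0\<close> by (intro mult_left_mono) auto
      also have "\<dots> = e u" using K0 e0 by (simp add: m_def)
      also have "\<dots> \<le> ll * \<mu> (place w u + t)" using bnd(1)[OF u(1) t True] .
      finally have 1: "ll * (m * \<mu> (place w u' + t)) \<le> ll * \<mu> (place w u + t)" by (simp add: mult.left_commute)
      have "ll * \<mu> (place w u + t) \<le> K * e u" using bnd(2)[OF u(1) t True] .
      also have "\<dots> = M * e u'" using e0 by (simp add: M_def)
      also have "\<dots> \<le> M * (ll * \<mu> (place w u' + t))"
        using bnd(1)[OF u(2) t True] e0 K0 by (intro mult_left_mono) (auto simp: M_def)
      finally have 2: "ll * \<mu> (place w u + t) \<le> ll * (M * \<mu> (place w u' + t))" by (simp add: mult.left_commute)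
      show ?thesis using 1 2 ll by (simp add: mult_le_cancel_left_pos)
    qed
  qed
  ultimately show ?thesis using that[of m M] mM by simp
qed

text \<open>
  Birkhoff's argument for positive matrices, in additive form: on the columns the vectors with
  entries \<open>\<mu> (u + s) - m * \<mu> (u' + s)\<close> and \<open>M * \<mu> (u' + s) - \<mu> (u + s)\<close> are nonnegative. Their sums
  \<open>p - m * q\<close> and \<open>M * q - p\<close> add up to \<open>(M - m) * q\<close>, and each row turns at least the share \<open>1 / K\<close> of
  them into an improvement of the two bounds.
\<close>

lemma sandwich_contract:
  assumes u: "u \<in> box" "u' \<in> box" and sw: "sandwich m M u u'" and m: "m \<le> M"
  obtains m' M' where "m \<le> m'" "m' \<le> M'" "M' - m' \<le> (1 - 1 / K) * (M - m)"
    "sandwich m' M' (place w u) (place w u')"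
proof -
  define p where "p = (\<Sum>s\<in>columns. \<mu> (u + s))"
  define q where "q = (\<Sum>s\<in>columns. \<mu> (u' + s))"
  define ll where "ll = l ^ length w"
  have ll: "ll > 0" using l_gt1 by (simp add: ll_def)
  have K0: "K > 1" using K_ge by simp
  have form: "ll * \<mu> (place w x + t) = (\<Sum>s\<in>gaps. entry w t s * \<mu> (x + s))"
    if "x \<in> box" "t \<in> gaps" for x t
    using mu_place[OF w_words that(1) gaps_all[OF that(2)]] by (simp add: ll_def)
  have q0: "q \<ge> 0" unfolding q_def using mu_nonneg by (intro sum_nonneg) auto
  have upper: "ll * \<mu> (place w u' + t) \<le> K * q" if "t \<in> gaps" "reach w1 t 0" for t
    using block_bounds(2)[OF that, of "\<lambda>s. \<mu> (u' + s)"] mu_nonneg form[OF u(2) that(1)] by (simp add: q_def)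
  have sub: "columns \<subseteq> gaps" by (auto simp: columns_def)
  have mono: "sandwich m M (place w u) (place w u')" using sandwich_place[OF sw w_words u] .
  show ?thesis
  proof (cases "q = 0")
    case True
    \<comment> \<open>Then both vectors vanish after \<open>w\<close>, and any constants do.\<close>
    have z: "\<mu> (place w u' + t) = 0" if "t \<in> gaps" for t
    proof (cases "reach w1 t 0")
      case r: True
      have "ll * \<mu> (place w u' + t) \<le> 0" using upper[OF that r] \<open>q = 0\<close> by simp
      then have "\<mu> (place w u' + t) \<le> 0" using ll by (simp add: mult_le_0_iff)
      then show ?thesis using mu_nonneg[of "place w u' + t"] by simp
    qed (use dead_row[OF u(2) that] in simp)
    then have "sandwich m m (place w u) (place w u')" using mono by (simp add: sandwich_def)
    moreover have "m - m \<le> (1 - 1 / K) * (M - m)" using K0 m by simp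
    ultimately show ?thesis using that[of m m] by simp
  next
    case False
    then have qpos: "q > 0" using q0 by simp
    define m' where "m' = m + (p - m * q) / (K * q)"
    define M' where "M' = M - (M * q - p) / (K * q)"
    have lo: "p - m * q = (\<Sum>s\<in>columns. \<mu> (u + s) - m * \<mu> (u' + s))"
      by (simp add: p_def q_def sum_subtractf sum_distrib_left)
    have hi: "M * q - p = (\<Sum>s\<in>columns. M * \<mu> (u' + s) - \<mu> (u + s))"
      by (simp add: p_def q_def sum_subtractf sum_distrib_left)
    have lo0: "p - m * q \<ge> 0" unfolding lo using sw sub by (intro sum_nonneg) (auto simp: sandwich_def)
    have hi0: "M * q - p \<ge> 0" unfolding hi using sw sub by (intro sum_nonneg) (auto simp: sandwich_def)
    have diff: "M' - m' = (1 - 1 / K) * (M - m)"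
      using qpos K0 by (simp add: M'_def m'_def field_simps)
    have "m \<le> m'" using lo0 qpos K0 by (simp add: m'_def)
    moreover have "(1 - 1 / K) * (M - m) \<ge> 0" using K0 m by simp
    then have "m' \<le> M'" using diff by linarith
    moreover have "sandwich m' M' (place w u) (place w u')"
      unfolding sandwich_def
    proof
      fix t assume t: "t \<in> gaps"
      show "m' * \<mu> (place w u' + t) \<le> \<mu> (place w u + t) \<and> \<mu> (place w u + t) \<le> M' * \<mu> (place w u' + t)"
      proof (cases "reach w1 t 0")
        case False
        then show ?thesis using dead_row u t by simp
      next
        case r: True
        define y where "y = ll * \<mu> (place w u + t)"
        define y' where "y' = ll * \<mu> (place w u' + t)"
        have y'K: "y' / (K * q) \<le> 1" using upper[OF t r] qpos K0 by (simp add: y'_def)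
        have "p - m * q \<le> (\<Sum>s\<in>gaps. entry w t s * (\<mu> (u + s) - m * \<mu> (u' + s)))"
          unfolding lo using sw sub by (intro block_bounds(1)[OF t r]) (auto simp: sandwich_def)
        also have "\<dots> = y - m * y'"
          unfolding y_def y'_def form[OF u(1) t] form[OF u(2) t]
          by (simp add: sum_subtractf sum_distrib_left algebra_simps)
        finally have 1: "m * y' + (p - m * q) \<le> y" by simp
        have "M * q - p \<le> (\<Sum>s\<in>gaps. entry w t s * (M * \<mu> (u' + s) - \<mu> (u + s)))"
          unfolding hi using sw sub by (intro block_bounds(1)[OF t r]) (auto simp: sandwich_def)
        also have "\<dots> = M * y' - y"
          unfolding y_def y'_def form[OF u(1) t] form[OF u(2) t]
          by (simp add: sum_subtractf sum_distrib_left algebra_simps)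
        finally have 2: "y \<le> M * y' - (M * q - p)" by simp
        have "m' * y' = m * y' + (p - m * q) * (y' / (K * q))" by (simp add: m'_def algebra_simps)
        moreover have "(p - m * q) * (y' / (K * q)) \<le> (p - m * q) * 1" using lo0 y'K by (intro mult_left_mono) auto
        ultimately have 3: "m' * y' \<le> y" using 1 by simp
        have "(M * q - p) * (y' / (K * q)) \<le> (M * q - p) * 1" using hi0 y'K by (intro mult_left_mono) auto
        moreover have "M' * y' = M * y' - (M * q - p) * (y' / (K * q))" by (simp add: M'_def algebra_simps)
        ultimately have 4: "y \<le> M' * y'" using 2 by simp
        have "ll * (m' * \<mu> (place w u' + t)) \<le> ll * \<mu> (place w u + t)"
          "ll * \<mu> (place w u + t) \<le> ll * (M' * \<mu> (place w u' + t))"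
          using 3 4 by (simp_all add: y_def y'_def mult.left_commute)
        then show ?thesis using ll by (simp add: mult_le_cancel_left_pos)
      qed
    qed
    ultimately show ?thesis using that[of m' M'] diff by simp
  qed
qed

end

section \<open>Copies of a word\<close>

lemma copies_split:
  assumes "contains_copies (Suc r) w a"
  obtains a1 a2 where "a = a1 @ w @ a2" "contains_copies r w a2"
proof -
  define n where "n = length w"
  obtain P where P: "finite P" "card P = Suc r"
    "\<And>p. p \<in> P \<Longrightarrow> p + n \<le> length a" "\<And>p. p \<in> P \<Longrightarrow> take n (drop p a) = w"
    "\<And>p q. p \<in> P \<Longrightarrow> q \<in> P \<Longrightarrow> p < q \<Longrightarrow> p + n \<le> q"
    using assms unfolding contains_copies_def n_def by blast
  define p where "p = Min P"
  have ne: "P \<noteq> {}" using P(2) by auto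
  have p: "p \<in> P" "\<And>q. q \<in> P \<Longrightarrow> p \<le> q" using P(1) ne by (auto simp: p_def)
  have later: "p + n \<le> q" if "q \<in> P - {p}" for q
    using that p(2)[of q] P(5)[OF p(1), of q] by force
  define Q where "Q = (\<lambda>q. q - (p + n)) ` (P - {p})"
  have inj: "inj_on (\<lambda>q. q - (p + n)) (P - {p})"
    using later by (intro inj_onI) (metis le_add_diff_inverse)
  have "contains_copies r w (drop (p + n) a)"
    unfolding contains_copies_def n_def[symmetric]
  proof (intro exI[of _ Q] conjI ballI impI)
    show "finite Q" using P(1) by (simp add: Q_def)
    show "card Q = r" using P(1,2) p(1) by (simp add: Q_def card_image[OF inj])
  next
    fix q' assume "q' \<in> Q"
    then obtain q where q: "q \<in> P - {p}" "q' = q - (p + n)" by (auto simp: Q_def)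
    show "q' + n \<le> length (drop (p + n) a)" using P(3)[of q] later[OF q(1)] q by auto
    show "take n (drop q' (drop (p + n) a)) = w" using P(4)[of q] later[OF q(1)] q by auto
  next
    fix q' s' assume "q' \<in> Q" "s' \<in> Q" and lt: "q' < s'"
    then obtain q s where q: "q \<in> P - {p}" "q' = q - (p + n)" and s: "s \<in> P - {p}" "s' = s - (p + n)"
      by (auto simp: Q_def)
    have "q < s" using lt q s by auto
    then have "q + n \<le> s" using P(5) q s by blast
    then show "q' + n \<le> s'" using q s later[OF q(1)] later[OF s(1)] by auto
  qed
  moreover have "a = take p a @ w @ drop (p + n) a"
    using P(4)[OF p(1)] append_take_drop_id[of p a] append_take_drop_id[of n "drop p a"]
    by (simp add: add.commute)
  ultimately show ?thesis using that by blast
qed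

text \<open>
  The first halves of the copies of \<open>w @ w\<close> are copies of \<open>w\<close>, and the second half of the last copy
  comes after all of them.
\<close>

lemma copies_of_square:
  assumes "contains_copies r (w @ w) a" "r \<ge> 1"
  obtains a1 a2 where "a = a1 @ w @ w @ a2" "contains_copies r w (a1 @ w)"
proof -
  define n where "n = length w"
  obtain P where P: "finite P" "card P = r"
    "\<And>p. p \<in> P \<Longrightarrow> p + (n + n) \<le> length a" "\<And>p. p \<in> P \<Longrightarrow> take (n + n) (drop p a) = w @ w"
    "\<And>p q. p \<in> P \<Longrightarrow> q \<in> P \<Longrightarrow> p < q \<Longrightarrow> p + (n + n) \<le> q"
    using assms(1) unfolding contains_copies_def n_def length_append by blast
  define p where "p = Max P"
  have ne: "P \<noteq> {}" using P(2) assms(2) by auto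
  have p: "p \<in> P" "\<And>q. q \<in> P \<Longrightarrow> q \<le> p" using P(1) ne by (auto simp: p_def)
  define a1 where "a1 = take p a"
  have len: "length a1 = p" using P(3)[OF p(1)] by (simp add: a1_def)
  have first: "take n (drop q a) = w" if "q \<in> P" for q
    using arg_cong[OF P(4)[OF that], of "take n"] by (simp add: n_def)
  have "contains_copies r w (a1 @ w)"
    unfolding contains_copies_def n_def[symmetric]
  proof (intro exI[of _ P] conjI ballI impI)
    fix q assume q: "q \<in> P"
    consider "q = p" | "q + (n + n) \<le> p" using p(2)[OF q] P(5)[OF q p(1)] by force
    note cases = this
    show "q + n \<le> length (a1 @ w)" using cases by cases (simp_all add: len n_def)
    show "take n (drop q (a1 @ w)) = w"
      using cases
    proof cases
      case 1
      then show ?thesis using len by (simp add: n_def)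
    next
      case 2
      then have "take n (drop q (a1 @ w)) = take n (drop q a)"
        using len by (simp add: a1_def drop_take)
      then show ?thesis using first[OF q] by simp
    qed
  next
    fix q s assume "q \<in> P" "s \<in> P" "q < s"
    then show "q + n \<le> s" using P(5)[of q s] by simp
  qed (use P in auto)
  moreover have "a = a1 @ w @ w @ drop (p + (n + n)) a"
    using P(4)[OF p(1)] append_take_drop_id[of p a] append_take_drop_id[of "n + n" "drop p a"]
    by (simp add: a1_def add.commute)
  ultimately show ?thesis using that by blast
qed

section \<open>Connectedness of the spectrum under gap translations\<close>

context hyperbolic_number begin

text \<open>
  A power \<open>\<beta> ^ N\<close> is a sum of \<open>N\<close> digits, and so is its product with a digit.
\<close>

lemma small_integer_gap:
  assumes "i \<in> digits" "j \<in> digits" shows "of_int i - of_int j \<in> all_gaps"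
proof -
  obtain N e where e: "\<And>i. e i \<in> {-1, 0, 1 :: int}" and top: "\<beta> ^ N = (\<Sum>i<N. of_int (e i) * \<beta> ^ i)"
    using beta_power_digits by metis
  define c where "c = map (\<lambda>i. e (N - Suc i)) [0..<N]"
  have "word_sum c \<beta> = (\<Sum>i<N. of_int (e (N - Suc i)) * \<beta> ^ (N - Suc i))"
    by (simp add: word_sum_def c_def)
  also have "\<dots> = \<beta> ^ N"
    unfolding top by (rule sum.nat_diff_reindex[where g = "\<lambda>i. of_int (e i) * \<beta> ^ i"])
  finally have "word_sum c \<beta> = \<beta> ^ N" .
  moreover have "c \<in> words" unfolding words_def c_def using e by fastforce
  ultimately have "\<beta> ^ N \<in> X N" using XI[of c N] by (simp add: c_def)
  then have mem: "\<beta> ^ N * of_int k \<in> X N" if "k \<in> digits" for k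
    using that X_uminus X_zero by auto
  have "\<beta> ^ N * (of_int i - of_int j) = \<beta> ^ N * of_int i - \<beta> ^ N * of_int j" by (simp add: algebra_simps)
  then show ?thesis unfolding all_gaps_def using mem[OF assms(1)] mem[OF assms(2)] by blast
qed

abbreviation linked :: "real \<Rightarrow> real \<Rightarrow> bool" where
  "linked \<equiv> (translation_step \<beta> gaps)\<^sup>*\<^sup>*"

lemma gap_step:
  assumes "x \<in> spectrum \<beta>" "y \<in> spectrum \<beta>" "y - x \<in> all_gaps" shows "linked x y"
proof -
  have "y - x \<in> gaps" using alive_gap[OF spectrum_box[OF assms(1)] assms(3)] assms(2) by simp
  then have "translation_step \<beta> gaps x y"
    unfolding translation_step_def using assms by (intro conjI bexI[of _ "y - x"]) auto
  then show ?thesis by blast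
qed

lemma spectrum_digit: "x \<in> spectrum \<beta> \<Longrightarrow> i \<in> digits \<Longrightarrow> \<beta> * x + of_int i \<in> spectrum \<beta>"
  using spectrum_concat[of x "of_int i" 1] X_1 by auto

lemma digit_change:
  assumes "x \<in> spectrum \<beta>" "i \<in> digits" "j \<in> digits"
  shows "linked (\<beta> * x + of_int i) (\<beta> * x + of_int j)"
proof -
  have "(\<beta> * x + of_int j) - (\<beta> * x + of_int i) \<in> all_gaps"
    using small_integer_gap[OF assms(3,2)] by simp
  then show ?thesis using assms by (intro gap_step spectrum_digit)
qed

text \<open>
  Let \<open>z - y = (x1 - y1) / \<beta> ^ k\<close>, and let \<open>c\<close> and \<open>d\<close> be the leading digits of \<open>x1\<close> and \<open>y1\<close>. Then
  \<open>\<beta> * z + d\<close> and \<open>\<beta> * y + c\<close> differ by a gap with one digit less, so a step from \<open>y\<close> to \<open>z\<close> lifts to a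
  step between these two numbers. Digit changes do the rest.
\<close>

lemma linked_lift:
  assumes "linked x y" "x \<in> spectrum \<beta>" "i \<in> digits" "j \<in> digits"
  shows "linked (\<beta> * x + of_int i) (\<beta> * y + of_int j)"
  using assms(1,4)
proof (induction arbitrary: j rule: rtranclp_induct)
  case base
  then show ?case using digit_change assms(2,3) by blast
next
  case (step y z)
  have yz: "y \<in> spectrum \<beta>" "z \<in> spectrum \<beta>" and "z - y \<in> gaps"
    using step.hyps(2) by (auto simp: translation_step_def)
  obtain k x1 y1 where k: "x1 \<in> X k" "y1 \<in> X k" "z - y = (x1 - y1) / \<beta> ^ k"
    using gaps_all[OF \<open>z - y \<in> gaps\<close>] by (rule all_gapsE)
  show ?case
  proof (cases k)
    case 0
    then have "z = y" using k by (simp add: X_0)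
    then show ?thesis using step.IH[OF step.prems] by simp
  next
    case (Suc m)
    obtain c x2 where c: "c \<in> X 1" "x2 \<in> X m" "x1 = \<beta> ^ m * c + x2"
      using X_split[of x1 1 m] k(1) Suc by auto
    obtain d y2 where d: "d \<in> X 1" "y2 \<in> X m" "y1 = \<beta> ^ m * d + y2"
      using X_split[of y1 1 m] k(2) Suc by auto
    obtain i' j' where ij: "i' \<in> digits" "c = of_int i'" "j' \<in> digits" "d = of_int j'"
      using c(1) d(1) unfolding X_1 by blast
    have e: "\<beta> ^ m * ((\<beta> * z + d) - (\<beta> * y + c)) = x2 - y2"
    proof -
      have "\<beta> ^ m * (\<beta> * (z - y)) = x1 - y1" using k(3) Suc by simp
      then show ?thesis using c(3) d(3) by (simp add: algebra_simps)
    qed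
    then have "(\<beta> * z + of_int j') - (\<beta> * y + of_int i') \<in> all_gaps"
      unfolding all_gaps_def using c(2) d(2) ij by blast
    then have "linked (\<beta> * y + of_int i') (\<beta> * z + of_int j')"
      using yz ij by (intro gap_step spectrum_digit) auto
    moreover have "linked (\<beta> * x + of_int i) (\<beta> * y + of_int i')" using step.IH[OF ij(1)] .
    moreover have "linked (\<beta> * z + of_int j') (\<beta> * z + of_int j)"
      using digit_change[OF yz(2) ij(3) step.prems] .
    ultimately show ?thesis by (meson rtranclp_trans)
  qed
qed

text \<open>
  Induction on the number of digits; the paths are lifted along \<open>\<lambda>y. \<beta> * y + j\<close>.
\<close>

lemma linked_zero: "x \<in> spectrum \<beta> \<Longrightarrow> linked 0 x"
proof -
  have "linked 0 x" if "x \<in> X n" for n x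
    using that
  proof (induction n arbitrary: x)
    case 0
    then show ?case by (simp add: X_0)
  next
    case (Suc n)
    then obtain y z where yz: "y \<in> X n" "z \<in> X 1" "x = \<beta> ^ 1 * y + z"
      using X_split[of x n 1] by auto
    obtain j where j: "j \<in> digits" "z = of_int j" using yz(2) unfolding X_1 by blast
    have "linked (\<beta> * 0 + of_int 0) (\<beta> * y + of_int j)"
      using linked_lift[OF Suc.IH[OF yz(1)] spectrum_zero _ j(1), of 0] by simp
    then show ?case using yz j by simp
  qed
  then show "x \<in> spectrum \<beta> \<Longrightarrow> linked 0 x" by (auto simp: spectrum_eq)
qed

section \<open>Cylinders\<close>

lemma foldr_ifs_apply:
  "b \<in> contr \<Longrightarrow> foldr (ifs_map \<beta>) a p b = word_sum (rev a) b + b ^ length a * p b"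
  by (induction a) (simp_all add: ifs_map_def word_sum_append word_sum_Cons algebra_simps)

lemma attractor_foldr: "a \<in> words \<Longrightarrow> p \<in> attractor \<beta> \<Longrightarrow> foldr (ifs_map \<beta>) a p \<in> attractor \<beta>"
  by (induction a) (auto simp: words_Cons intro!: attractor_step)

lemma attractor_unfold:
  assumes "p \<in> attractor \<beta>"
  shows "\<exists>c\<in>words. length c = n \<and> (\<exists>q\<in>attractor \<beta>. p = foldr (ifs_map \<beta>) c q)"
  using assms
proof (induction n arbitrary: p)
  case 0
  then show ?case by (intro bexI[of _ "[]"]) (auto simp: words_Nil)
next
  case (Suc n)
  obtain i q where i: "i \<in> digits" "q \<in> attractor \<beta>" "p = ifs_map \<beta> i q"
    using attractor_unstep[OF Suc.prems] by blast
  obtain c r where c: "c \<in> words" "length c = n" "r \<in> attractor \<beta>" "q = foldr (ifs_map \<beta>) c r"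
    using Suc.IH[OF i(2)] by blast
  have "i # c \<in> words" using i(1) c(1) by (simp add: words_Cons)
  then show ?case using c i by (intro bexI[of _ "i # c"]) auto
qed

lemma emb_place:
  assumes "b \<in> conjs" "u \<in> Zbeta" shows "emb b (rsum a + \<beta> ^ length a * u) = word_sum (rev a) b + b ^ length a * emb b u"
proof -
  have "rsum a \<in> Zbeta"
  proof -
    have "word_sum c \<beta> \<in> Zbeta" for c
      by (induction c) (use Zbeta_int[of 0] in \<open>auto simp: word_sum_Cons intro!: Zbeta_add Zbeta_mult Zbeta_int Zbeta_pow Zbeta_beta\<close>)
    then show ?thesis .
  qed
  then show ?thesis using assms by (simp add: emb_add emb_mult emb_pow emb_beta emb_word_sum Zbeta_mult Zbeta_pow Zbeta_beta)
qed

text \<open>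
  The number \<open>u\<close> need not belong to the spectrum, because the cylinder may contain the point of \<open>x\<close>
  without any code of \<open>x\<close> ending accordingly. All that survives is the bound for the attractor, and
  this is why base points range over \<open>box\<close>.
\<close>

lemma cylinder_decompose:
  assumes "x \<in> spectrum \<beta>" "contracted \<beta> x \<in> cylinder \<beta> a" "a \<in> words"
  obtains u where "u \<in> box" "x = rsum a + \<beta> ^ length a * u"
proof -
  obtain p where p: "p \<in> attractor \<beta>" "contracted \<beta> x = foldr (ifs_map \<beta>) a p"
    using assms(2) by (auto simp: cylinder_def)
  define u where "u = (x - rsum a) / \<beta> ^ length a"
  have x: "x = rsum a + \<beta> ^ length a * u" by (simp add: u_def)
  have uL: "u \<in> Zbeta" unfolding u_def using spectrum_Zbeta[OF assms(1)] X_Zbeta[OF rsum_X[OF assms(3)]]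
    by (intro Zbeta_div Zbeta_diff)
  have "emb b u = p b" if b: "b \<in> contr" for b
  proof -
    have "word_sum (rev a) b + b ^ length a * emb b u = emb b x"
      using emb_place[OF contr_conj[OF b] uL] x by simp
    also have "\<dots> = contracted \<beta> x b" using contracted_eq[OF assms(1)] b by simp
    also have "\<dots> = word_sum (rev a) b + b ^ length a * p b" using p(2) foldr_ifs_apply[OF b] by simp
    finally show ?thesis using conj_ne0[OF contr_conj[OF b]] by simp
  qed
  then have "u \<in> box" using uL attractor_bound[OF p(1)] by (simp add: box_def)
  then show ?thesis using that x by blast
qed

lemma contracted_place:
  assumes "u \<in> spectrum \<beta>" "a \<in> words"
  shows "contracted \<beta> (rsum a + \<beta> ^ length a * u) = foldr (ifs_map \<beta>) a (contracted \<beta> u)"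
proof -
  have "rsum a + \<beta> ^ length a * u \<in> spectrum \<beta>"
    using spectrum_concat[OF assms(1) rsum_X[OF assms(2)]] by (simp add: add.commute)
  then have "contracted \<beta> (rsum a + \<beta> ^ length a * u) = (\<lambda>b\<in>contr. emb b (rsum a + \<beta> ^ length a * u))"
    by (rule contracted_eq)
  also have "\<dots> = foldr (ifs_map \<beta>) a (contracted \<beta> u)"
  proof (rule extensionalityI[of _ contr])
    have "foldr (ifs_map \<beta>) a (contracted \<beta> u) \<in> extensional contr"
      by (cases a) (simp_all add: contracted_eq[OF assms(1)] ifs_map_def)
    then show "foldr (ifs_map \<beta>) a (contracted \<beta> u) \<in> extensional contr" .
  qed (use assms(1) in \<open>simp_all add: foldr_ifs_apply emb_place contr_conj spectrum_Zbeta contracted_eq\<close>)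
  finally show ?thesis .
qed

lemma contracted_attractor: "x \<in> spectrum \<beta> \<Longrightarrow> contracted \<beta> x \<in> attractor \<beta>"
proof -
  assume "x \<in> spectrum \<beta>"
  then obtain c where c: "c \<in> words" "x = word_sum c \<beta>" by (auto simp: spectrum_def)
  have "contracted \<beta> 0 = (\<lambda>b\<in>contr. 0)"
    unfolding contracted_eq[OF spectrum_zero] using emb_int[of _ 0] contr_conj by fastforce
  then have "contracted \<beta> 0 \<in> attractor \<beta>" using attractor_zero by simp
  moreover have "contracted \<beta> x = foldr (ifs_map \<beta>) (rev c) (contracted \<beta> 0)"
    using contracted_place[OF spectrum_zero, of "rev c"] c by (simp add: words_rev)
  ultimately show ?thesis using attractor_foldr[of "rev c"] c by (simp add: words_rev)
qed

end

section \<open>The ratio functions\<close>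

context merging begin

lemma alive_tail: "alive (place a u) \<Longrightarrow> a \<in> words \<Longrightarrow> u \<in> box \<Longrightarrow> alive u"
  unfolding alive_def using pull_gap gaps_all by metis

lemma spectrum_alive: "x \<in> spectrum \<beta> \<Longrightarrow> alive x"
  unfolding alive_def using zero_gap by force

text \<open>
  The innermost copy makes the two vectors comparable, every further copy contracts, and the
  stretches in between preserve the bounds.
\<close>

lemma sandwich_copies:
  assumes "contains_copies (Suc r) w a" "a \<in> words" "u \<in> box" "u' \<in> box"
    "alive (place a u)" "alive (place a u')"
  shows "\<exists>m M. m > 0 \<and> m \<le> M \<and> M - m \<le> K\<^sup>2 * (1 - 1 / K) ^ r * m \<and> sandwich m M (place a u) (place a u')"
  using assms
proof (induction r arbitrary: a)
  case 0
  obtain a1 a2 where a: "a = a1 @ w @ a2" using copies_split[OF 0(1)] by metis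
  have aw: "a1 \<in> words" "a2 \<in> words" using 0(2) by (auto simp: a words_append)
  have pl: "place a x = place a1 (place w (place a2 x))" for x unfolding a by (simp only: place_append)
  have y: "place a2 u \<in> box" "place a2 u' \<in> box" using box_word aw 0 by auto
  have z: "place w (place a2 u) \<in> box" "place w (place a2 u') \<in> box" using box_word w_words y by auto
  have "alive (place w (place a2 u))" "alive (place w (place a2 u'))"
    using alive_tail[OF _ aw(1)] z 0(5,6) unfolding pl by blast+
  then obtain m M where m: "m > 0" "m \<le> M" "M - m \<le> K\<^sup>2 * m"
    "sandwich m M (place w (place a2 u)) (place w (place a2 u'))"
    using sandwich_first[OF y] by blast
  have "sandwich m M (place a u) (place a u')" unfolding pl by (rule sandwich_place[OF m(4) aw(1) z])
  then show ?case using m by auto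
next
  case (Suc r)
  obtain a1 a2 where a: "a = a1 @ w @ a2" "contains_copies (Suc r) w a2"
    using copies_split[OF Suc.prems(1)] by metis
  have aw: "a1 \<in> words" "a2 \<in> words" using Suc.prems(2) by (auto simp: a words_append)
  have pl: "place a x = place a1 (place w (place a2 x))" for x unfolding a(1) by (simp only: place_append)
  have y: "place a2 u \<in> box" "place a2 u' \<in> box" using box_word aw Suc.prems by auto
  have z: "place w (place a2 u) \<in> box" "place w (place a2 u') \<in> box" using box_word w_words y by auto
  have "alive (place a2 u)" "alive (place a2 u')"
    using alive_tail[OF alive_tail[OF _ aw(1) z(1)] w_words y(1)]
      alive_tail[OF alive_tail[OF _ aw(1) z(2)] w_words y(2)] Suc.prems(5,6) unfolding pl by blast+
  from Suc.IH[OF a(2) aw(2) Suc.prems(3,4) this] obtain m M where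
    m: "m > 0" "m \<le> M" "M - m \<le> K\<^sup>2 * (1 - 1 / K) ^ r * m" "sandwich m M (place a2 u) (place a2 u')"
    by blast
  obtain m' M' where m': "m \<le> m'" "m' \<le> M'" "M' - m' \<le> (1 - 1 / K) * (M - m)"
    "sandwich m' M' (place w (place a2 u)) (place w (place a2 u'))"
    using sandwich_contract[OF y m(4,2)] .
  have k: "0 \<le> 1 - 1 / K" using K_ge by simp
  have "M' - m' \<le> (1 - 1 / K) * (K\<^sup>2 * (1 - 1 / K) ^ r * m)"
    using m'(3) mult_left_mono[OF m(3) k] by linarith
  also have "\<dots> = K\<^sup>2 * (1 - 1 / K) ^ Suc r * m" by simp
  also have "\<dots> \<le> K\<^sup>2 * (1 - 1 / K) ^ Suc r * m'"
    using m'(1) k by (intro mult_left_mono) auto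
  finally have "M' - m' \<le> K\<^sup>2 * (1 - 1 / K) ^ Suc r * m'" .
  moreover have "sandwich m' M' (place a u) (place a u')"
    unfolding pl by (rule sandwich_place[OF m'(4) aw(1) z])
  ultimately show ?case using m' m(1) by (intro exI[of _ m'] exI[of _ M']) auto
qed

definition ratio :: "real \<Rightarrow> real \<Rightarrow> real" where
  "ratio t x = ln (\<mu> (x + t) / \<mu> x)"

text \<open>
  The numbers whose images prescribe the function that belongs to \<open>t\<close>.
\<close>

definition movable :: "real \<Rightarrow> real set" where
  "movable t = {x \<in> spectrum \<beta>. x + t \<in> spectrum \<beta>}"

text \<open>
  The exponent is \<open>r - 1\<close> because one of the copies is spent on making the vectors comparable.
\<close>

definition err :: "nat \<Rightarrow> real" where
  "err r = K\<^sup>2 * (1 - 1 / K) ^ (r - 1)"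

text \<open>
  The square leaves room for a change of cylinder: its last copy contains a copy of \<open>w\<close> for the
  estimate and a second one in which the other cylinder is reached (lemma \<open>linking_point\<close>).
\<close>

abbreviation "W \<equiv> w @ w"

lemma ratio_place:
  assumes "contains_copies r w a" "r \<ge> 1" "a \<in> words" "u \<in> box" "u' \<in> box" "t \<in> gaps"
    and x: "place a u \<in> movable t" "place a u' \<in> movable t"
  shows "\<bar>ratio t (place a u) - ratio t (place a u')\<bar> \<le> err r"
proof -
  define x x' where "x = place a u" and "x' = place a u'"
  have "contains_copies (Suc (r - 1)) w a" using assms(1,2) by simp
  from sandwich_copies[OF this assms(3-5)] obtain m M where
    m: "m > 0" "m \<le> M" "M - m \<le> err r * m" "sandwich m M x x'"
    using x spectrum_alive unfolding x_def x'_def err_def movable_def by blast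
  have pos: "\<mu> x > 0" "\<mu> x' > 0" "\<mu> (x + t) > 0" "\<mu> (x' + t) > 0"
    using x mu_pos unfolding x_def x'_def movable_def by auto
  have M0: "M > 0" using m by simp
  have bnd: "m * \<mu> x' \<le> \<mu> x" "\<mu> x \<le> M * \<mu> x'" "m * \<mu> (x' + t) \<le> \<mu> (x + t)" "\<mu> (x + t) \<le> M * \<mu> (x' + t)"
    using m(4) assms(6) zero_gap unfolding sandwich_def by force+
  have lb: "ln (m * y) = ln m + ln y" "ln (M * y) = ln M + ln y" if "y > 0" for y
    using that m(1) M0 by (simp_all add: ln_mult)
  have le: "ln (m * \<mu> x') \<le> ln (\<mu> x)" "ln (\<mu> x) \<le> ln (M * \<mu> x')"
    "ln (m * \<mu> (x' + t)) \<le> ln (\<mu> (x + t))" "ln (\<mu> (x + t)) \<le> ln (M * \<mu> (x' + t))"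
    using bnd pos m(1) M0 by (simp_all add: ln_le_cancel_iff)
  have "ln M - ln m = ln (M / m)" using m(1) M0 by (simp add: ln_div)
  also have "\<dots> \<le> M / m - 1" using m(1) M0 by (intro ln_le_minus_one) simp
  also have "\<dots> = (M - m) / m" using m(1) by (simp add: field_simps)
  also have "\<dots> \<le> err r" using m(1,3) by (simp add: field_simps)
  finally have "ln M - ln m \<le> err r" .
  then show ?thesis
    using le pos unfolding ratio_def x_def[symmetric] x'_def[symmetric] by (simp add: lb ln_div abs_le_iff)
qed

lemma ratio_cylinder:
  assumes "contains_copies r W a" "r \<ge> 1" "a \<in> words" "t \<in> gaps"
    and "x \<in> movable t" "contracted \<beta> x \<in> cylinder \<beta> a" "x' \<in> movable t" "contracted \<beta> x' \<in> cylinder \<beta> a"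
  shows "\<bar>ratio t x - ratio t x'\<bar> \<le> err r"
proof -
  obtain a1 a2 where a: "a = a1 @ w @ w @ a2" "contains_copies r w (a1 @ w)"
    using copies_of_square[OF assms(1,2)] .
  obtain u where u: "u \<in> box" "x = place a u" using cylinder_decompose assms by (auto simp: movable_def)
  obtain u' where u': "u' \<in> box" "x' = place a u'" using cylinder_decompose assms by (auto simp: movable_def)
  have aw: "a1 @ w \<in> words" "w @ a2 \<in> words" using assms(3) by (auto simp: a words_append)
  have pl: "place a y = place (a1 @ w) (place (w @ a2) y)" for y
    using place_append[of "a1 @ w" "w @ a2" y] by (simp add: a(1))
  show ?thesis
    using ratio_place[OF a(2) assms(2) aw(1) box_word[OF u(1) aw(2)] box_word[OF u'(1) aw(2)] assms(4)]
      assms(5,7) u(2) u'(2) pl by simp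
qed

text \<open>
  Cylinders overlap, and estimates in two cylinders through the same point \<open>y\<close> have to agree. Two
  addresses of \<open>y\<close>, one through \<open>a\<close> and one through \<open>b\<close>, are separated by a gap \<open>s\<close> after the last copy
  of \<open>w\<close> in \<open>a\<close>. By the property of \<open>v\<close> this gap is reached from \<open>0\<close> along \<open>v\<close> alone. So the sum \<open>z\<close> of a
  continuation of \<open>b\<close> also has an expansion that follows \<open>a\<close> until the last \<open>v\<close>; it lies in the
  cylinder of \<open>b\<close>, and it shares \<open>r\<close> copies of \<open>w\<close> with \<open>x\<close>.
\<close>

lemma linking_point:
  assumes a: "contains_copies r W a" "r \<ge> 1" "a \<in> words" and b: "b \<in> words" and t: "t \<in> gaps"
    and y: "y \<in> cylinder \<beta> a" "y \<in> cylinder \<beta> b"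
    and x: "x \<in> movable t" "contracted \<beta> x \<in> cylinder \<beta> a"
  obtains z where "z \<in> movable t" "contracted \<beta> z \<in> cylinder \<beta> b" "\<bar>ratio t x - ratio t z\<bar> \<le> err r"
proof -
  obtain a1 a2 where a': "a = a1 @ w @ w @ a2" "contains_copies r w (a1 @ w)"
    using copies_of_square[OF a(1,2)] .
  define a0 where "a0 = a1 @ w"
  define e where "e = a0 @ w"
  define n where "n = length e"
  have aw: "a0 \<in> words" "a2 \<in> words" "e \<in> words" using a(3) by (auto simp: a' a0_def e_def words_append)
  have ae: "a = e @ a2" by (simp add: a' a0_def e_def)
  obtain p0 where "p0 \<in> attractor \<beta>" "y = foldr (ifs_map \<beta>) a p0" using y(1) by (auto simp: cylinder_def)
  then obtain p where p: "p \<in> attractor \<beta>" "y = foldr (ifs_map \<beta>) e p"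
    using attractor_foldr[OF aw(2)] unfolding ae foldr_append comp_apply by blast
  obtain q where q: "q \<in> attractor \<beta>" "y = foldr (ifs_map \<beta>) b q" using y(2) by (auto simp: cylinder_def)
  \<comment> \<open>The word \<open>b\<close> may be shorter than \<open>a\<close>; its address of \<open>y\<close> is continued.\<close>
  obtain c q2 where c: "c \<in> words" "length c = n" "q2 \<in> attractor \<beta>" "q = foldr (ifs_map \<beta>) c q2"
    using attractor_unfold[OF q(1), of n] by blast
  define b1 b3 where "b1 = take n (b @ c)" and "b3 = drop n (b @ c)"
  have bb: "b1 @ b3 = b @ c" "length b1 = n"
    using c(2) unfolding b1_def b3_def append_take_drop_id by simp_all
  have bw: "b1 \<in> words" "b3 \<in> words" using words_append[of b1 b3] words_append[of b c] b c(1) bb by auto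
  define p' where "p' = foldr (ifs_map \<beta>) b3 q2"
  have p': "p' \<in> attractor \<beta>" "y = foldr (ifs_map \<beta>) b1 p'"
  proof -
    show "p' \<in> attractor \<beta>" unfolding p'_def using attractor_foldr bw(2) c(3) by blast
    have "y = foldr (ifs_map \<beta>) (b @ c) q2" using q(2) c(4) by simp
    also have "\<dots> = foldr (ifs_map \<beta>) (b1 @ b3) q2" using bb by simp
    finally show "y = foldr (ifs_map \<beta>) b1 p'" by (simp add: p'_def)
  qed
  \<comment> \<open>The gap between the two addresses after \<open>n\<close> digits.\<close>
  define s where "s = (rsum e - rsum b1) / \<beta> ^ n"
  have b1s: "rsum b1 = rsum e - \<beta> ^ n * s" by (simp add: s_def)
  have eX: "rsum e \<in> X n" and bX: "rsum b1 \<in> X n" using rsum_X[OF aw(3)] rsum_X[OF bw(1)] bb by (auto simp: n_def)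
  have sall: "s \<in> all_gaps" unfolding all_gaps_def using eX bX b1s by force
  have "cmod (emb k s) \<le> 2 / (1 - cmod k)" if k: "k \<in> contr" for k
  proof -
    have "emb k s = (word_sum (rev e) k - word_sum (rev b1) k) / k ^ n"
      unfolding s_def using contr_conj[OF k] X_Zbeta[OF eX] X_Zbeta[OF bX]
      by (simp add: emb_div emb_diff Zbeta_diff emb_word_sum)
    also have "\<dots> = p' k - p k"
    proof -
      have "word_sum (rev e) k + k ^ n * p k = word_sum (rev b1) k + k ^ n * p' k"
        using p(2) p'(2) foldr_ifs_apply[OF k, of e p] foldr_ifs_apply[OF k, of b1 p'] bb by (simp add: n_def)
      then have "word_sum (rev e) k - word_sum (rev b1) k = k ^ n * (p' k - p k)" by (simp add: algebra_simps)
      then show ?thesis using conj_ne0[OF contr_conj[OF k]] by simp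
    qed
    finally have "cmod (emb k s) \<le> cmod (p' k) + cmod (p k)" by (simp add: norm_triangle_ineq4)
    also have "\<dots> \<le> 1 / (1 - cmod k) + 1 / (1 - cmod k)"
      using attractor_bound[OF p'(1) k] attractor_bound[OF p(1) k] by (rule add_mono)
    finally show ?thesis by simp
  qed
  then have s_gap: "s \<in> gaps" using sall by (simp add: gaps_def)
  have a0w1: "a0 @ w1 \<in> words" using aw(1) w1 by (simp add: words_append)
  have e2: "e = (a0 @ w1) @ v" by (simp add: e_def w_def)
  have "reach e 0 s" using bX b1s by (simp add: reach_def n_def)
  then obtain s1 where s1: "reach (a0 @ w1) 0 s1" "reach v s1 s" unfolding e2 by (rule reach_appendE)
  have "s1 \<in> gaps"
    using reach_gaps_back[OF s_gap _ v(1) s1(2)] reach_all_gaps[OF gaps_all[OF zero_gap] a0w1 s1(1)] by blast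
  \<comment> \<open>An expansion that agrees with \<open>a\<close> until the last \<open>v\<close> can still end at distance \<open>s\<close>.\<close>
  then have r0: "reach v 0 s" using column s_gap s1(2) by blast
  define y2 where "y2 = rsum v - \<beta> ^ length v * s + \<beta> ^ length v * rsum b3"
  have y2: "y2 \<in> spectrum \<beta>"
    using spectrum_concat[OF spectrumI[OF rsum_X[OF bw(2)]], of "rsum v - \<beta> ^ length v * s" "length v"] r0
    by (simp add: reach_def y2_def add.commute)
  \<comment> \<open>The two expansions of \<open>z\<close>: one along \<open>b\<close>, the other along \<open>a0 @ w1\<close>.\<close>
  define z where "z = rsum (b @ c)"
  have z1: "z = place (a0 @ w1) y2"
  proof -
    have "z = rsum b1 + \<beta> ^ n * rsum b3" unfolding z_def bb(1)[symmetric] rsum_append bb(2) ..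
    also have "\<dots> = rsum ((a0 @ w1) @ v) - \<beta> ^ length ((a0 @ w1) @ v) * s + \<beta> ^ length ((a0 @ w1) @ v) * rsum b3"
      unfolding b1s n_def e2 ..
    also have "\<dots> = place (a0 @ w1) y2"
      unfolding rsum_append[of "a0 @ w1" v] y2_def by (simp add: power_add algebra_simps)
    finally show ?thesis .
  qed
  have zs: "z \<in> spectrum \<beta>" unfolding z_def using spectrumI rsum_X b c(1) words_append by blast
  have "contracted \<beta> z = foldr (ifs_map \<beta>) b (contracted \<beta> (rsum c))"
    unfolding z_def rsum_append by (rule contracted_place[OF spectrumI[OF rsum_X[OF c(1)]] b])
  then have zb: "contracted \<beta> z \<in> cylinder \<beta> b"
    using contracted_attractor[OF spectrumI[OF rsum_X[OF c(1)]]] by (auto simp: cylinder_def)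
  have xs: "x \<in> spectrum \<beta>" "x + t \<in> spectrum \<beta>" using x(1) by (auto simp: movable_def)
  obtain u where u: "u \<in> box" "x = place a u" using cylinder_decompose[OF xs(1) x(2) a(3)] .
  define u2 where "u2 = place a2 u"
  have u2: "u2 \<in> box" using box_word[OF u(1) aw(2)] by (simp add: u2_def)
  have wu2: "place w u2 \<in> box" using box_word[OF u2 w_words] .
  have x0: "x = place a0 (place w u2)" unfolding u(2) ae e_def u2_def place_append ..
  have "place a0 (place w u2) + t \<in> spectrum \<beta>" using xs x0 by simp
  then obtain t1 where t1: "reach a0 t t1" "place w u2 + t1 \<in> spectrum \<beta>" "t1 \<in> gaps"
    using pull_gap[OF _ aw(1) wu2 gaps_all[OF t]] by blast
  \<comment> \<open>The translate \<open>x + t\<close> forces \<open>t\<close> to reach \<open>0\<close> along \<open>a0 @ w1\<close>, so that \<open>z + t\<close> is in the spectrum too.\<close>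
  have "reach (a0 @ w1) t 0" using reach_append[OF t1(1) alive_row(1)[OF u2 t1(3,2)]] .
  then have "place (a0 @ w1) y2 + t \<in> spectrum \<beta>" using spectrum_push[of "a0 @ w1" t 0 y2] y2 by simp
  then have zd: "z \<in> movable t" using zs z1 by (simp add: movable_def)
  have z0: "z = place a0 (place w1 y2)" unfolding z1 place_append ..
  have "\<bar>ratio t x - ratio t z\<bar> \<le> err r"
    unfolding x0 z0
  proof (rule ratio_place[OF _ a(2) aw(1) wu2 box_word[OF spectrum_box[OF y2] w1] t])
    show "contains_copies r w a0" using a'(2) by (simp add: a0_def)
    show "place a0 (place w u2) \<in> movable t" using x(1) x0 by simp
    show "place a0 (place w1 y2) \<in> movable t" using zd z0 by simp
  qed
  then show ?thesis using that zd zb by blast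
qed

text \<open>
  The lower bounds at \<open>y\<close> that the prescribed values and the variation estimate impose.
\<close>

definition extension_values :: "real \<Rightarrow> (complex \<Rightarrow> complex) \<Rightarrow> real set" where
  "extension_values t y = {ratio t x - err r | a r x. a \<in> words \<and> r \<ge> 1 \<and> contains_copies r W a \<and>
     y \<in> cylinder \<beta> a \<and> x \<in> movable t \<and> contracted \<beta> x \<in> cylinder \<beta> a}"

text \<open>
  At points that no cylinder estimate concerns, the value is \<open>Sup {}\<close>; it is unspecified but the same
  for all of them.
\<close>

definition ratio_fun :: "real \<Rightarrow> (complex \<Rightarrow> complex) \<Rightarrow> real" where
  "ratio_fun t y = (if \<exists>x\<in>movable t. contracted \<beta> x = y then ratio t (THE x. x \<in> movable t \<and> contracted \<beta> x = y)
     else Sup (extension_values t y))"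

lemma ratio_fun_contracted: "x \<in> movable t \<Longrightarrow> ratio_fun t (contracted \<beta> x) = ratio t x"
proof -
  assume x: "x \<in> movable t"
  have "(THE x'. x' \<in> movable t \<and> contracted \<beta> x' = contracted \<beta> x) = x"
    using x contracted_inj by (intro the_equality) (auto simp: movable_def)
  then show ?thesis using x by (auto simp: ratio_fun_def)
qed

text \<open>
  The lower bounds are consistent with the upper bounds: if the prescribed points \<open>x'\<close> and \<open>x\<close> lie in
  two cylinders through \<open>y\<close>, then \<open>linking_point\<close> supplies a prescribed point \<open>z\<close> in the second cylinder that
  is compared with \<open>x'\<close> along the first one and with \<open>x\<close> along the second one.
\<close>

lemma ratio_fun_near_ratio:
  assumes a: "contains_copies r W a" "r \<ge> 1" "a \<in> words" and t: "t \<in> gaps"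
    and y: "y \<in> cylinder \<beta> a" and x: "x \<in> movable t" "contracted \<beta> x \<in> cylinder \<beta> a"
  shows "\<bar>ratio_fun t y - ratio t x\<bar> \<le> err r"
proof (cases "\<exists>x\<in>movable t. contracted \<beta> x = y")
  case True
  then obtain x0 where "x0 \<in> movable t" "contracted \<beta> x0 = y" by blast
  then show ?thesis using ratio_fun_contracted[of x0 t] ratio_cylinder[OF a t _ _ x] y by auto
next
  case False
  have mem: "ratio t x - err r \<in> extension_values t y"
    unfolding extension_values_def using a y x by blast
  have upper: "h \<le> ratio t x + err r" if "h \<in> extension_values t y" for h
  proof -
    obtain b r' x' where h: "h = ratio t x' - err r'" "b \<in> words" "r' \<ge> 1" "contains_copies r' W b"
      "y \<in> cylinder \<beta> b" "x' \<in> movable t" "contracted \<beta> x' \<in> cylinder \<beta> b"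
      using \<open>h \<in> extension_values t y\<close> unfolding extension_values_def by blast
    obtain z where "z \<in> movable t" "contracted \<beta> z \<in> cylinder \<beta> a" "\<bar>ratio t x' - ratio t z\<bar> \<le> err r'"
      using linking_point[OF h(4,3,2) a(3) t h(5) y h(6,7)] .
    moreover from this have "\<bar>ratio t z - ratio t x\<bar> \<le> err r" using ratio_cylinder[OF a t _ _ x] by blast
    ultimately show ?thesis using h(1) by linarith
  qed
  have "ratio t x - err r \<le> Sup (extension_values t y)"
    using mem upper by (intro cSup_upper) (auto simp: bdd_above_def)
  moreover have "Sup (extension_values t y) \<le> ratio t x + err r"
    using mem upper by (intro cSup_least) auto
  ultimately show ?thesis using False by (simp add: ratio_fun_def abs_le_iff)
qed

text \<open>
  If the cylinder contains no prescribed point, then by \<open>linking_point\<close> neither does any cylinder of a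
  word with a copy of \<open>W\<close> that meets it, and the function is constant on it.
\<close>

lemma ratio_fun_variation:
  assumes a: "contains_copies r W a" "r \<ge> 1" "a \<in> words" and t: "t \<in> gaps"
    and y: "y \<in> cylinder \<beta> a" "y' \<in> cylinder \<beta> a"
  shows "\<bar>ratio_fun t y - ratio_fun t y'\<bar> \<le> 2 * K\<^sup>2 * (1 - 1 / K) ^ (r - 1)"
proof (cases "\<exists>x\<in>movable t. contracted \<beta> x \<in> cylinder \<beta> a")
  case True
  then obtain x where x: "x \<in> movable t" "contracted \<beta> x \<in> cylinder \<beta> a" by blast
  then show ?thesis
    using ratio_fun_near_ratio[OF a t y(1) x] ratio_fun_near_ratio[OF a t y(2) x] unfolding err_def by linarith
next
  case False
  have "ratio_fun t q = Sup {}" if q: "q \<in> cylinder \<beta> a" for q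
  proof -
    have "extension_values t q = {}"
    proof (rule ccontr)
      assume "extension_values t q \<noteq> {}"
      then obtain b r' x' where h: "b \<in> words" "r' \<ge> 1" "contains_copies r' W b"
        "q \<in> cylinder \<beta> b" "x' \<in> movable t" "contracted \<beta> x' \<in> cylinder \<beta> b"
        unfolding extension_values_def by blast
      show False using linking_point[OF h(3,2,1) a(3) t h(4) q h(5,6)] False by blast
    qed
    then show ?thesis using q False by (auto simp: ratio_fun_def)
  qed
  then have "ratio_fun t y = ratio_fun t y'" using y by simp
  then show ?thesis using K_ge by simp
qed

end

section \<open>The theorem\<close>

theorem theorem1p3:
  fixes \<beta> l :: real
  assumes "hyperbolic \<beta>"
    and "is_growth_rate \<beta> l"
    and "X_bar \<beta> \<inter> (K_space \<beta> closure_of B_box \<beta>) =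
         Z_bar \<beta>
         \<inter> {x \<in> topspace (K_space \<beta>). proj_c \<beta> x \<in> Kc_space \<beta> interior_of attractor \<beta>}
         \<inter> (K_space \<beta> closure_of B_box \<beta>)"
  shows "\<exists>(\<Delta> :: real set) (f :: real \<Rightarrow> (complex \<Rightarrow> complex) \<Rightarrow> real).
    finite \<Delta> \<and>
    (\<forall>v \<in> \<Delta>. \<forall>x \<in> spectrum \<beta>. x + v \<in> spectrum \<beta> \<longrightarrow>
        ln (mu \<beta> l (x + v) / mu \<beta> l x) = f v (contracted \<beta> x)) \<and>
    (\<forall>x \<in> spectrum \<beta>. (translation_step \<beta> \<Delta>)\<^sup>*\<^sup>* 0 x) \<and>
    (\<exists>w C1 C2. w \<in> words \<and> w \<noteq> [] \<and> C1 > 0 \<and> 0 < C2 \<and> C2 < 1 \<and>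
        (\<forall>a \<in> words. \<forall>r \<ge> 1. contains_copies r w a \<longrightarrow>
           (\<forall>v \<in> \<Delta>. \<forall>y \<in> cylinder \<beta> a. \<forall>y' \<in> cylinder \<beta> a.
              \<bar>f v y - f v y'\<bar> \<le> C1 * C2 ^ (r - 1))))"
proof -
  interpret growth \<beta> l
    using assms(1,2) by unfold_locales
  obtain v where v: "v \<in> words" "v \<noteq> []"
    "\<And>t s. \<lbrakk>t \<in> gaps; s \<in> gaps; reach v t s\<rbrakk> \<Longrightarrow> reach v 0 s"
    using column_word by blast
  obtain w1 where w1: "w1 \<in> words"
    "\<And>t s. \<lbrakk>t \<in> gaps; s \<in> gaps; reach w1 t s; mergeable s\<rbrakk> \<Longrightarrow> reach w1 t 0"
    using row_word by blast
  interpret merging \<beta> l w1 v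
    using v w1 by unfold_locales
  have log_ratios: "ln (\<mu> (x + t) / \<mu> x) = ratio_fun t (contracted \<beta> x)"
    if "x \<in> spectrum \<beta>" "x + t \<in> spectrum \<beta>" for x t
    using ratio_fun_contracted[of x t] that by (simp add: movable_def ratio_def)
  have "K > 1" using K_ge by simp
  then have "2 * K\<^sup>2 > 0" "0 < 1 - 1 / K" "1 - 1 / K < 1" by simp_all
  moreover have "W \<in> words" "W \<noteq> []" using w_words w_ne by (simp_all add: words_append)
  ultimately have "\<exists>w C1 C2. w \<in> words \<and> w \<noteq> [] \<and> C1 > 0 \<and> 0 < C2 \<and> C2 < 1 \<and>
      (\<forall>a \<in> words. \<forall>r \<ge> 1. contains_copies r w a \<longrightarrow>
         (\<forall>t \<in> gaps. \<forall>y \<in> cylinder \<beta> a. \<forall>y' \<in> cylinder \<beta> a.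
            \<bar>ratio_fun t y - ratio_fun t y'\<bar> \<le> C1 * C2 ^ (r - 1)))"
    using ratio_fun_variation
    by (intro exI[of _ W] exI[of _ "2 * K\<^sup>2"] exI[of _ "1 - 1 / K"] conjI) blast+
  then show ?thesis using finite_gaps log_ratios linked_zero
    by (intro exI[of _ gaps] exI[of _ ratio_fun] conjI) blast+
qed

end
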